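(* Let $\beta>1$ and $0<\zeta/\alpha<2$. For any fixed integer $m\ge2$ and any collection of $m$ distinct vertices $v_1,\dots,v_m$ of $\mathcal{G}(N;\zeta,\alpha,\beta)$, their degrees $D_{v_1},\dots,D_{v_m}$ are asymptotically independent: for all non-negative integers $k_1,\dots,k_m$, $$\Pr[D_{v_1}=k_1,\dots,D_{v_m}=k_m]-\prod_{i=1}^m\Pr[D_{v_i}=k_i]\to0\quad\text{as }N\to\infty,$$ uniformly over the choice of the $m$ vertices.
   Context: Model $\mathcal{G}(N;\zeta,\alpha,\beta)$: fix $0<\zeta<2$, $\alpha>0$, $\beta>0$. For a positive integer $N$ let $R$ be defined by $N=e^{\zeta R/2}$. Native representation of the hyperbolic plane of curvature $-\zeta^2$: points in polar coordinates $(r,\theta)$, $r$ the hyperbolic distance from the origin; the distance between $u=(r_u,\theta_u)$, $v=(r_v,\theta_v)$ is given by $\cosh(\zeta d(u,v))=\cosh(\zeta r_u)\cosh(\zeta r_v)-\sinh(\zeta r_u)\sinh(\zeta r_v)\cos(\theta_{u,v})$, $\theta_{u,v}\in[0,\pi]$ the relative angle. The $N$ vertices are independent random points in the disc of radius $R$ about the origin, with angle uniform on $(0,2\pi]$ and, independently, radius with density $\rho(r)=\alpha\frac{\sinh(\alpha r)}{\cosh(\alpha R)-1}$ on $[0,R]$. Given positions, distinct $u,v$ are joined independently with probability $\frac{1}{\exp\left(\beta\frac{\zeta}{2}(d(u,v)-R)\right)+1}$. $D_v$ denotes the degree of $v$. *)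

theory Defs
  imports "HOL-Probability.Probability"
begin

text \<open>
  A point of the hyperbolic plane of curvature \<open>-\<zeta>\<^sup>2\<close> is a pair \<open>(r, \<theta>)\<close> of polar coordinates
  in the native representation; the vertices of the random graph on \<open>N\<close> vertices are
  \<open>0, \<dots>, N - 1\<close>, and a graph on them is given by its set of edges, each a two-element set.
\<close>

definition hyp_radius :: "real \<Rightarrow> nat \<Rightarrow> real" where
  "hyp_radius \<zeta> N = 2 / \<zeta> * ln (real N)"

text \<open>For angles in \<open>(0, 2\<pi>]\<close>, the following is the angle in \<open>[0, \<pi>]\<close> between the two rays.\<close>

definition rel_angle :: "real \<Rightarrow> real \<Rightarrow> real" where
  "rel_angle \<theta> \<theta>' = pi - \<bar>pi - \<bar>\<theta> - \<theta>'\<bar>\<bar>"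

definition hyp_dist :: "real \<Rightarrow> real \<times> real \<Rightarrow> real \<times> real \<Rightarrow> real" where
  "hyp_dist \<zeta> p q =
     arcosh (cosh (\<zeta> * fst p) * cosh (\<zeta> * fst q)
       - sinh (\<zeta> * fst p) * sinh (\<zeta> * fst q) * cos (rel_angle (snd p) (snd q))) / \<zeta>"

definition radius_density :: "real \<Rightarrow> real \<Rightarrow> real \<Rightarrow> real" where
  "radius_density \<alpha> R r =
     (if 0 \<le> r \<and> r \<le> R then \<alpha> * sinh (\<alpha> * r) / (cosh (\<alpha> * R) - 1) else 0)"

definition point_measure_hyp :: "real \<Rightarrow> real \<Rightarrow> (real \<times> real) measure" where
  "point_measure_hyp \<alpha> R =
     density lborel (\<lambda>r. ennreal (radius_density \<alpha> R r)) \<Otimes>\<^sub>M uniform_measure lborel {0<..2 * pi}"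

definition positions :: "real \<Rightarrow> real \<Rightarrow> nat \<Rightarrow> (nat \<Rightarrow> real \<times> real) measure" where
  "positions \<zeta> \<alpha> N = (\<Pi>\<^sub>M v\<in>{..<N}. point_measure_hyp \<alpha> (hyp_radius \<zeta> N))"

definition edge_prob :: "real \<Rightarrow> real \<Rightarrow> real \<Rightarrow> real \<times> real \<Rightarrow> real \<times> real \<Rightarrow> real" where
  "edge_prob \<zeta> \<beta> R p q = 1 / (exp (\<beta> * (\<zeta> / 2) * (hyp_dist \<zeta> p q - R)) + 1)"

definition vertex_pairs :: "nat \<Rightarrow> (nat \<times> nat) set" where
  "vertex_pairs N = {(u, v). u < v \<and> v < N}"

definition graph_given_positions ::
    "real \<Rightarrow> real \<Rightarrow> nat \<Rightarrow> (nat \<Rightarrow> real \<times> real) \<Rightarrow> nat set set pmf" where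
  "graph_given_positions \<zeta> \<beta> N x =
     map_pmf (\<lambda>\<omega>. {{u, v} | u v. \<omega> (u, v)})
       (Pi_pmf (vertex_pairs N) False
         (\<lambda>(u, v). bernoulli_pmf (edge_prob \<zeta> \<beta> (hyp_radius \<zeta> N) (x u) (x v))))"

definition hyp_random_graph :: "nat \<Rightarrow> real \<Rightarrow> real \<Rightarrow> real \<Rightarrow> nat set set measure" where
  "hyp_random_graph N \<zeta> \<alpha> \<beta> =
     positions \<zeta> \<alpha> N \<bind> (\<lambda>x. measure_pmf (graph_given_positions \<zeta> \<beta> N x))"

definition graph_degree :: "nat set set \<Rightarrow> nat \<Rightarrow> nat" where
  "graph_degree G v = card {u. {u, v} \<in> G}"

text \<open>
  For \<open>N = 1\<close> the disc degenerates (\<open>R = 0\<close>) and there is no radial density, hence the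
  condition \<open>2 \<le> N\<close> below.
\<close>

lemma exp_hyp_radius: "0 < \<zeta> \<Longrightarrow> 0 < N \<Longrightarrow> exp (\<zeta> * hyp_radius \<zeta> N / 2) = real N"
  by (simp add: hyp_radius_def)

lemma hyp_dist_cosh:
  fixes p q :: "real \<times> real"
  assumes "0 < \<zeta>" "0 \<le> fst p" "0 \<le> fst q"
  shows "cosh (\<zeta> * hyp_dist \<zeta> p q) =
           cosh (\<zeta> * fst p) * cosh (\<zeta> * fst q)
           - sinh (\<zeta> * fst p) * sinh (\<zeta> * fst q) * cos (rel_angle (snd p) (snd q))"
    and "0 \<le> hyp_dist \<zeta> p q"
proof -
  let ?a = "\<zeta> * fst p" and ?b = "\<zeta> * fst q" and ?c = "cos (rel_angle (snd p) (snd q))"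
  have "sinh ?a * sinh ?b * ?c \<le> sinh ?a * sinh ?b * 1"
    using assms by (intro mult_left_mono) auto
  moreover have "1 \<le> cosh (?a - ?b)" by (rule cosh_real_ge_1)
  ultimately have ge: "1 \<le> cosh ?a * cosh ?b - sinh ?a * sinh ?b * ?c"
    by (simp add: cosh_diff)
  show "cosh (\<zeta> * hyp_dist \<zeta> p q) = cosh ?a * cosh ?b - sinh ?a * sinh ?b * ?c"
    using ge assms by (simp add: hyp_dist_def)
  show "0 \<le> hyp_dist \<zeta> p q"
    using ge assms by (simp add: hyp_dist_def)
qed

lemma rel_angle_props:
  assumes "\<theta> \<in> {0<..2 * pi}" "\<theta>' \<in> {0<..2 * pi}"
  shows "rel_angle \<theta> \<theta>' \<in> {0..pi}" "cos (rel_angle \<theta> \<theta>') = cos (\<theta> - \<theta>')"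
proof -
  show "rel_angle \<theta> \<theta>' \<in> {0..pi}"
    using assms by (auto simp: rel_angle_def abs_if)
  show "cos (rel_angle \<theta> \<theta>') = cos (\<theta> - \<theta>')"
    by (auto simp: rel_angle_def cos_diff abs_if cos_add)
qed

lemma edge_prob_range: "0 \<le> edge_prob \<zeta> \<beta> R p q" "edge_prob \<zeta> \<beta> R p q \<le> 1"
  by (simp_all add: edge_prob_def add_nonneg_nonneg add_pos_pos)

lemma finite_vertex_pairs: "finite (vertex_pairs N)"
  by (rule finite_subset[of _ "{..<N} \<times> {..<N}"]) (auto simp: vertex_pairs_def)

lemma prob_space_radius:
  assumes "0 < \<alpha>" "0 < R"
  shows "prob_space (density lborel (\<lambda>r. ennreal (radius_density \<alpha> R r)))"
proof (rule prob_spaceI)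
  have c: "0 < cosh (\<alpha> * R) - 1"
    using assms cosh_real_strict_mono[of 0 "\<alpha> * R"] by simp
  let ?f = "\<lambda>r. \<alpha> * sinh (\<alpha> * r) / (cosh (\<alpha> * R) - 1)"
  let ?F = "\<lambda>r. cosh (\<alpha> * r) / (cosh (\<alpha> * R) - 1)"
  have [measurable]: "?f \<in> borel_measurable borel"
    using c by (intro borel_measurable_continuous_onI continuous_intros) auto
  have eq: "ennreal (radius_density \<alpha> R r) = ennreal (?f r) * indicator {0..R} r" for r
    by (auto simp: radius_density_def indicator_def)
  have "emeasure (density lborel (\<lambda>r. ennreal (radius_density \<alpha> R r))) UNIV
      = (\<integral>\<^sup>+ r. ennreal (?f r) * indicator {0..R} r \<partial>lborel)"
    unfolding eq by (subst emeasure_density) simp_all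
  also have "\<dots> = ennreal (?F R - ?F 0)"
  proof (rule nn_integral_FTC_Icc)
    fix r assume r: "r \<in> {0..R}"
    show "DERIV ?F r :> ?f r"
      by (rule DERIV_cdivide) (auto intro!: derivative_eq_intros)
    show "0 \<le> ?f r"
      using c assms r by (intro divide_nonneg_pos mult_nonneg_nonneg) auto
  qed (use assms in auto)
  also have "?F R - ?F 0 = 1"
    using c assms by (simp add: diff_divide_distrib[symmetric])
  finally show "emeasure (density lborel (\<lambda>r. ennreal (radius_density \<alpha> R r)))
      (space (density lborel (\<lambda>r. ennreal (radius_density \<alpha> R r)))) = 1" by simp
qed

lemma sets_point_measure_hyp [measurable_cong]: "sets (point_measure_hyp \<alpha> R) = sets borel"
proof -
  have "sets (point_measure_hyp \<alpha> R) = sets (borel \<Otimes>\<^sub>M borel)"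
    unfolding point_measure_hyp_def by (rule sets_pair_measure_cong) simp_all
  then show ?thesis by (simp only: borel_prod)
qed

lemma prob_space_point_measure_hyp:
  assumes "0 < \<alpha>" "0 < R"
  shows "prob_space (point_measure_hyp \<alpha> R)"
proof -
  interpret A: prob_space "density lborel (\<lambda>r. ennreal (radius_density \<alpha> R r))"
    using assms by (rule prob_space_radius)
  interpret B: prob_space "uniform_measure lborel {0<..2 * pi}"
    by (rule prob_space_uniform_measure) auto
  interpret pair_prob_space "density lborel (\<lambda>r. ennreal (radius_density \<alpha> R r))"
    "uniform_measure lborel {0<..2 * pi}" ..
  show ?thesis
    unfolding point_measure_hyp_def by (rule prob_space_axioms)
qed

lemma prob_space_positions:
  assumes "0 < \<zeta>" "0 < \<alpha>" "2 \<le> N"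
  shows "prob_space (positions \<zeta> \<alpha> N)"
  unfolding positions_def
  using assms by (intro prob_space_PiM prob_space_point_measure_hyp) (auto simp: hyp_radius_def)

lemma measurable_edge_prob:
  "(\<lambda>z. edge_prob \<zeta> \<beta> R (fst z) (snd z)) \<in> borel_measurable (borel \<Otimes>\<^sub>M borel)"
proof -
  have [measurable]: "(fst :: real \<times> real \<Rightarrow> real) \<in> borel_measurable borel"
    "(snd :: real \<times> real \<Rightarrow> real) \<in> borel_measurable borel"
    by (simp_all add: borel_prod[symmetric])
  have [measurable]: "(cosh :: real \<Rightarrow> real) \<in> borel_measurable borel"
    "(sinh :: real \<Rightarrow> real) \<in> borel_measurable borel"
    by (auto intro!: borel_measurable_continuous_onI continuous_intros)
  show ?thesis
    unfolding edge_prob_def hyp_dist_def rel_angle_def arcosh_def by measurable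
qed

lemma measurable_graph_given_positions:
  "(\<lambda>x. measure_pmf (graph_given_positions \<zeta> \<beta> N x))
     \<in> measurable (positions \<zeta> \<alpha> N) (subprob_algebra (count_space UNIV))"
proof (rule measurable_subprob_algebra)
  let ?R = "hyp_radius \<zeta> N"
  let ?E = "vertex_pairs N"
  let ?S = "PiE_dflt ?E False (\<lambda>_. UNIV)"
  let ?g = "\<lambda>\<omega>. {{u, v} | u v. \<omega> (u, v)} :: nat set set"
  let ?B = "\<lambda>x (u, v). bernoulli_pmf (edge_prob \<zeta> \<beta> ?R (x u) (x v))"
  fix A :: "nat set set set"
  have finS: "finite ?S"
    using finite_vertex_pairs by auto
  have comp: "(\<lambda>x. x w) \<in> measurable (positions \<zeta> \<alpha> N) borel" if "w < N" for w
    unfolding positions_def using that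
    by (subst measurable_cong_sets[OF refl sets_point_measure_hyp[symmetric]])
      (auto intro: measurable_component_singleton)
  have ep: "(\<lambda>x. edge_prob \<zeta> \<beta> ?R (x u) (x v)) \<in> borel_measurable (positions \<zeta> \<alpha> N)"
    if "(u, v) \<in> ?E" for u v
  proof -
    have "u < N" "v < N" using that by (auto simp: vertex_pairs_def)
    then have "(\<lambda>x. (x u, x v)) \<in> measurable (positions \<zeta> \<alpha> N) (borel \<Otimes>\<^sub>M borel)"
      by (intro measurable_Pair comp)
    from measurable_compose[OF this measurable_edge_prob] show ?thesis by simp
  qed
  have eq: "emeasure (measure_pmf (graph_given_positions \<zeta> \<beta> N x)) A =
      ennreal (\<Sum>\<omega>\<in>?S \<inter> ?g -` A. \<Prod>(u, v)\<in>?E.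
        if \<omega> (u, v) then edge_prob \<zeta> \<beta> ?R (x u) (x v) else 1 - edge_prob \<zeta> \<beta> ?R (x u) (x v))"
    for x
  proof -
    let ?P = "Pi_pmf ?E False (?B x)"
    have "emeasure (measure_pmf (graph_given_positions \<zeta> \<beta> N x)) A = emeasure (measure_pmf ?P) (?g -` A)"
      by (simp add: graph_given_positions_def)
    also have "\<dots> = emeasure (measure_pmf ?P) (?S \<inter> ?g -` A)"
      using set_Pi_pmf_subset'[OF finite_vertex_pairs, of N False "?B x"]
      by (intro emeasure_eq_AE) (auto simp: AE_measure_pmf_iff PiE_dflt_def)
    also have "\<dots> = ennreal (\<Sum>\<omega>\<in>?S \<inter> ?g -` A. pmf ?P \<omega>)"
      using finS by (simp add: measure_pmf.emeasure_eq_measure measure_measure_pmf_finite)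
    also have "(\<Sum>\<omega>\<in>?S \<inter> ?g -` A. pmf ?P \<omega>) = (\<Sum>\<omega>\<in>?S \<inter> ?g -` A. \<Prod>(u, v)\<in>?E.
        if \<omega> (u, v) then edge_prob \<zeta> \<beta> ?R (x u) (x v) else 1 - edge_prob \<zeta> \<beta> ?R (x u) (x v))"
      by (intro sum.cong refl, subst pmf_Pi')
        (auto simp: finite_vertex_pairs PiE_dflt_def edge_prob_range intro!: prod.cong)
    finally show ?thesis .
  qed
  have factor: "(\<lambda>x. if \<omega> (u, v) then edge_prob \<zeta> \<beta> ?R (x u) (x v)
      else 1 - edge_prob \<zeta> \<beta> ?R (x u) (x v)) \<in> borel_measurable (positions \<zeta> \<alpha> N)"
    if "(u, v) \<in> ?E" for u v and \<omega> :: "nat \<times> nat \<Rightarrow> bool"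
    using ep[OF that] by (cases "\<omega> (u, v)") auto
  show "(\<lambda>x. emeasure (measure_pmf (graph_given_positions \<zeta> \<beta> N x)) A)
      \<in> borel_measurable (positions \<zeta> \<alpha> N)"
    unfolding eq
    by (intro measurable_compose[OF _ measurable_ennreal] borel_measurable_sum
        borel_measurable_prod) (auto intro!: factor)
qed (auto intro: measure_pmf.subprob_space_axioms)

lemma prob_space_hyp_random_graph:
  assumes "0 < \<zeta>" "0 < \<alpha>" "2 \<le> N"
  shows "prob_space (hyp_random_graph N \<zeta> \<alpha> \<beta>)"
    and "sets (hyp_random_graph N \<zeta> \<alpha> \<beta>) = UNIV"
    and "space (hyp_random_graph N \<zeta> \<alpha> \<beta>) = UNIV"
proof -
  interpret prob_space "positions \<zeta> \<alpha> N"
    using assms by (rule prob_space_positions)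
  show "prob_space (hyp_random_graph N \<zeta> \<alpha> \<beta>)"
    unfolding hyp_random_graph_def
    by (rule prob_space_bind[OF _ measurable_graph_given_positions])
      (simp add: measure_pmf.prob_space_axioms)
  show "sets (hyp_random_graph N \<zeta> \<alpha> \<beta>) = UNIV"
    unfolding hyp_random_graph_def
    by (subst sets_bind_measurable[OF measurable_graph_given_positions not_empty]) simp
  then show "space (hyp_random_graph N \<zeta> \<alpha> \<beta>) = UNIV"
    by (metis UNIV_I sets.sets_into_space top.extremum_uniqueI)
qed

end

theory Submission
  imports Defs "HOL-Real_Asymp.Real_Asymp"
begin

text \<open>
  Let \<open>q(y)\<close> be the probability that a random point is adjacent to \<open>y\<close>. Given the positions of the
  \<open>m\<close> vertices, every other vertex contributes independently to their degrees. Replacing its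
  contributions by independent ones changes the joint law only if it has two neighbours among the
  \<open>m\<close> vertices, so all replacements together cost a constant times \<open>N E q\<^sup>2\<close>; edges among the \<open>m\<close>
  vertices cost \<open>E q \<le> (E q\<^sup>2)\<^sup>1\<^sup>/\<^sup>2\<close>. After the replacement, the degrees are functions of the
  independent positions of the \<open>m\<close> vertices. Hence it is enough that \<open>N E q\<^sup>2 \<rightarrow> 0\<close>. The distance
  formula bounds an edge probability by a multiple of \<open>(N exp (- \<zeta> (r + s) / 2) / \<phi>)\<^sup>\<gamma>\<close> for every
  \<open>\<gamma> \<le> \<beta>\<close>, where \<open>\<phi>\<close> is the relative angle. With \<open>\<gamma> = 3/4\<close> this is integrable and yields
  \<open>q(s, \<theta>) = O(exp (- 3 \<zeta> s / 8))\<close>, so that \<open>E q\<^sup>2 = O(N powr (- 2 c / \<zeta>))\<close> for some \<open>c > \<zeta> / 2\<close>,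
  as \<open>\<alpha> > \<zeta> / 2\<close>.
\<close>

section \<open>Counts of independent Bernoulli trials\<close>

text \<open>The mean of \<open>g\<close> at the number of successes in independent trials of success probability \<open>t w\<close>.\<close>

definition bernoulli_count_mean :: "'i set \<Rightarrow> ('i \<Rightarrow> real) \<Rightarrow> (nat \<Rightarrow> real) \<Rightarrow> real" where
  "bernoulli_count_mean W t g =
     (\<Sum>S\<in>Pow W. g (card S) * (\<Prod>w\<in>W. if w \<in> S then t w else 1 - t w))"

lemma bernoulli_count_mean_empty [simp]: "bernoulli_count_mean {} t g = g 0"
  by (simp add: bernoulli_count_mean_def)

lemma bernoulli_count_mean_cong:
  assumes "\<And>w. w \<in> W \<Longrightarrow> t w = t' w"
  shows "bernoulli_count_mean W t g = bernoulli_count_mean W t' g"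
  unfolding bernoulli_count_mean_def using assms by (auto intro!: sum.cong prod.cong)

lemma bernoulli_count_mean_affine:
  "bernoulli_count_mean W t (\<lambda>n. c * g n + d * h n) =
     c * bernoulli_count_mean W t g + d * bernoulli_count_mean W t h"
  unfolding bernoulli_count_mean_def
  by (simp add: sum_distrib_left sum.distrib algebra_simps)

text \<open>Conditioning on the trial \<open>w\<close>: the subsets of \<open>insert w W\<close> are
  those of \<open>W\<close>, with and without \<open>w\<close> added, and adding \<open>w\<close>
  raises the count by one.\<close>

lemma bernoulli_count_mean_insert:
  assumes "finite W" "w \<notin> W"
  shows "bernoulli_count_mean (insert w W) t g =
     t w * bernoulli_count_mean W t (\<lambda>n. g (Suc n)) + (1 - t w) * bernoulli_count_mean W t g"
proof -
  let ?P = "\<lambda>S. \<Prod>u\<in>insert w W. if u \<in> S then t u else 1 - t u"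
  let ?Q = "\<lambda>S. \<Prod>u\<in>W. if u \<in> S then t u else 1 - t u"
  have inj: "inj_on (insert w) (Pow W)"
    using assms by (auto simp: inj_on_def)
  have P1: "?P S = (1 - t w) * ?Q S" if "S \<in> Pow W" for S
    using assms that by (auto simp: subset_iff)
  have P2: "?P (insert w S) = t w * ?Q S" if "S \<in> Pow W" for S
  proof -
    have "(\<Prod>u\<in>W. if u \<in> insert w S then t u else 1 - t u) = ?Q S"
      using assms by (intro prod.cong) auto
    then show ?thesis using assms by simp
  qed
  have c: "card (insert w S) = Suc (card S)" if "S \<in> Pow W" for S
    using assms that by (metis PowD card_insert_disjoint finite_subset in_mono)
  have "bernoulli_count_mean (insert w W) t g =
      (\<Sum>S\<in>Pow W. g (card S) * ?P S) + (\<Sum>S\<in>insert w ` Pow W. g (card S) * ?P S)"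
    unfolding bernoulli_count_mean_def Pow_insert
    using assms by (subst sum.union_disjoint) auto
  also have "(\<Sum>S\<in>insert w ` Pow W. g (card S) * ?P S) =
      (\<Sum>S\<in>Pow W. g (Suc (card S)) * (t w * ?Q S))"
    by (subst sum.reindex[OF inj], rule sum.cong) (use P2 c in \<open>simp_all only: o_def\<close>)
  also have "(\<Sum>S\<in>Pow W. g (card S) * ?P S) = (\<Sum>S\<in>Pow W. g (card S) * ((1 - t w) * ?Q S))"
    by (rule sum.cong) (use P1 in simp_all)
  finally show ?thesis
    unfolding bernoulli_count_mean_def
    by (simp add: sum_distrib_left mult_ac)
qed

lemma convex_unit_range:
  fixes t a b :: real
  assumes "t \<in> {0..1}" "a \<in> {0..1}" "b \<in> {0..1}"
  shows "t * a + (1 - t) * b \<in> {0..1}"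
proof -
  have "t * a + (1 - t) * b \<le> t * 1 + (1 - t) * 1"
    using assms by (intro add_mono mult_left_mono) auto
  then show ?thesis using assms by auto
qed

lemma prod_unit_range:
  fixes f :: "'i \<Rightarrow> real"
  assumes "\<And>v. v \<in> V \<Longrightarrow> f v \<in> {0..1}"
  shows "(\<Prod>v\<in>V. f v) \<in> {0..1}"
  using prod_nonneg[of V f] prod_le_1[of V f] assms by auto

lemma bernoulli_count_mean_range:
  assumes "finite W" "\<And>w. w \<in> W \<Longrightarrow> t w \<in> {0..1}" "\<And>n. g n \<in> {0..1}"
  shows "bernoulli_count_mean W t g \<in> {0..1}"
  using assms
proof (induction W arbitrary: g rule: finite_induct)
  case (insert w W)
  then show ?case
    by (subst bernoulli_count_mean_insert) (auto intro!: convex_unit_range simp del: atLeastAtMost_iff)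
qed simp

lemma borel_measurable_bernoulli_count_mean [measurable (raw)]:
  assumes "\<And>w. w \<in> W \<Longrightarrow> (\<lambda>x. t x w) \<in> borel_measurable M"
    and "\<And>n. (\<lambda>x. g x n) \<in> borel_measurable M"
  shows "(\<lambda>x. bernoulli_count_mean W (t x) (g x)) \<in> borel_measurable M"
proof -
  have "(\<lambda>x. if w \<in> S then t x w else 1 - t x w) \<in> borel_measurable M" if "w \<in> W" for w S
    using assms(1)[OF that] by (cases "w \<in> S") auto
  then show ?thesis
    unfolding bernoulli_count_mean_def
    by (intro borel_measurable_sum borel_measurable_times borel_measurable_prod assms(2))
qed

section \<open>Expectations, covariances and products of functions with values in the unit
  interval\<close>

lemma (in prob_space) integrable_unit_range:
  fixes f :: "'a \<Rightarrow> real"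
  assumes "f \<in> borel_measurable M" "\<And>x. x \<in> space M \<Longrightarrow> f x \<in> {0..1}"
  shows "integrable M f"
  using assms by (intro integrable_const_bound[where B = 1]) auto

lemma (in prob_space) expectation_unit_range:
  fixes f :: "'a \<Rightarrow> real"
  assumes "f \<in> borel_measurable M" "\<And>x. x \<in> space M \<Longrightarrow> f x \<in> {0..1}"
  shows "expectation f \<in> {0..1}"
proof -
  have "0 \<le> expectation f"
    using assms by (intro integral_nonneg_AE AE_I2) auto
  moreover have "expectation f \<le> 1"
    using assms by (intro integral_le_const integrable_unit_range AE_I2) auto
  ultimately show ?thesis by auto
qed

text \<open>Replacing \<open>X\<close> by \<open>X - c\<close> leaves the covariance unchanged.
  Afterwards its two terms are bounded separately through
  \<open>\<bar>X x - c\<bar> \<le> Z x\<close>.\<close>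

lemma (in prob_space) covariance_bound:
  fixes X Y Z :: "'a \<Rightarrow> real"
  assumes "integrable M X" "integrable M Y" "integrable M Z"
    and "integrable M (\<lambda>x. X x * Y x)" "integrable M (\<lambda>x. Z x * Y x)"
    and "\<And>x. x \<in> space M \<Longrightarrow> \<bar>X x - c\<bar> \<le> Z x" "\<And>x. x \<in> space M \<Longrightarrow> 0 \<le> Y x"
  shows "\<bar>expectation (\<lambda>x. X x * Y x) - expectation X * expectation Y\<bar>
    \<le> expectation (\<lambda>x. Z x * Y x) + expectation Z * expectation Y"
proof -
  have "0 \<le> expectation Y"
    using assms by (intro integral_nonneg_AE AE_I2) auto
  moreover have "\<bar>expectation (\<lambda>x. (X x - c) * Y x)\<bar> \<le> expectation (\<lambda>x. Z x * Y x)"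
  proof (rule order.trans[OF integral_abs_bound integral_mono])
    fix x assume "x \<in> space M"
    then show "\<bar>(X x - c) * Y x\<bar> \<le> Z x * Y x"
      using assms(6,7)[of x] by (simp add: abs_mult mult_right_mono)
  qed (use assms in \<open>auto simp: left_diff_distrib\<close>)
  moreover have "\<bar>expectation (\<lambda>x. X x - c)\<bar> \<le> expectation Z"
    by (rule order.trans[OF integral_abs_bound integral_mono]) (use assms in auto)
  moreover have "expectation (\<lambda>x. (X x - c) * Y x) = expectation (\<lambda>x. X x * Y x) - c * expectation Y"
    unfolding left_diff_distrib using assms by (subst Bochner_Integration.integral_diff) auto
  moreover have "expectation (\<lambda>x. X x - c) = expectation X - c"
    using assms by (subst Bochner_Integration.integral_diff) (auto simp: prob_space)
  ultimately have "0 \<le> expectation Y"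
    and "\<bar>expectation (\<lambda>x. X x * Y x) - c * expectation Y\<bar> \<le> expectation (\<lambda>x. Z x * Y x)"
    and "\<bar>expectation X * expectation Y - c * expectation Y\<bar> \<le> expectation Z * expectation Y"
    by (simp_all add: left_diff_distrib[symmetric] abs_mult mult_right_mono)
  then show ?thesis by linarith
qed

text \<open>Constants drop out of a covariance, so each further factor costs only joint moments of order two.\<close>

lemma (in prob_space) expectation_prod_affine_diff:
  fixes f :: "'i \<Rightarrow> 'a \<Rightarrow> real" and A B :: "'i \<Rightarrow> real"
  assumes "finite V"
    and "\<And>v. v \<in> V \<Longrightarrow> f v \<in> borel_measurable M"
    and "\<And>v x. v \<in> V \<Longrightarrow> x \<in> space M \<Longrightarrow> f v x \<in> {0..1}"
    and "\<And>v. v \<in> V \<Longrightarrow> A v \<in> {0..1}" "\<And>v. v \<in> V \<Longrightarrow> B v \<in> {0..1}"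
  shows "\<bar>expectation (\<lambda>x. \<Prod>v\<in>V. f v x * A v + (1 - f v x) * B v)
      - (\<Prod>v\<in>V. expectation (f v) * A v + (1 - expectation (f v)) * B v)\<bar>
    \<le> (\<Sum>u\<in>V. \<Sum>v\<in>V - {u}. expectation (\<lambda>x. f u x * f v x) + expectation (f u) * expectation (f v))"
  using assms
proof (induction V rule: finite_induct)
  case empty
  then show ?case by (simp add: prob_space)
next
  case (insert v V)
  let ?D = "\<lambda>u w. expectation (\<lambda>x. f u x * f w x) + expectation (f u) * expectation (f w)"
  let ?L = "\<lambda>u x. f u x * A u + (1 - f u x) * B u"
  let ?X = "\<lambda>x. \<Prod>u\<in>V. ?L u x"
  let ?c = "\<Prod>u\<in>V. B u"
  let ?EY = "expectation (f v) * A v + (1 - expectation (f v)) * B v"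
  have m [measurable]: "f u \<in> borel_measurable M" if "u \<in> insert v V" for u
    using insert.prems(1) that by blast
  have r: "f u x \<in> {0..1}" if "u \<in> insert v V" "x \<in> space M" for u x
    using insert.prems(2) that by blast
  have AB: "A u \<in> {0..1}" "B u \<in> {0..1}" if "u \<in> insert v V" for u
    using insert.prems(3,4) that by blast+
  have Er: "expectation (f u) \<in> {0..1}" if "u \<in> insert v V" for u
    using m[OF that] r[OF that] by (rule expectation_unit_range)
  have if2: "integrable M (\<lambda>x. f u x * f w x)" if "u \<in> insert v V" "w \<in> insert v V" for u w
    using that m[OF that(1)] m[OF that(2)] r[OF that(1)] r[OF that(2)]
    by (intro integrable_unit_range) (auto intro: mult_le_one)
  have if1: "integrable M (f u)" if "u \<in> insert v V" for u
    using m[OF that] r[OF that] by (rule integrable_unit_range)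
  have D0: "0 \<le> ?D u w" if "u \<in> insert v V" "w \<in> insert v V" for u w
    using Er[OF that(1)] Er[OF that(2)] r[OF that(1)] r[OF that(2)]
    by (intro add_nonneg_nonneg integral_nonneg_AE AE_I2) auto
  have Lr: "?L u x \<in> {0..1}" if "u \<in> insert v V" "x \<in> space M" for u x
    using r[OF that] AB[OF that(1)] by (intro convex_unit_range)
  have Xr: "?X x \<in> {0..1}" if "x \<in> space M" for x
    using Lr that by (intro prod_unit_range) auto
  have cr: "?c \<in> {0..1}"
    using AB by (intro prod_unit_range) auto
  have Xm [measurable]: "?X \<in> borel_measurable M"
    using m by (intro borel_measurable_prod borel_measurable_add borel_measurable_times) auto
  have iX: "integrable M ?X"
    using Xm Xr by (rule integrable_unit_range)
  have iXf: "integrable M (\<lambda>x. ?X x * f v x)"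
    using Xr r[of v] m[of v] Xm by (intro integrable_unit_range) (auto intro: mult_le_one)
  \<comment> \<open>\<open>?c\<close> is the value of \<open>?X\<close> when all \<open>f u\<close>
    vanish, and the factor at \<open>u\<close> deviates from \<open>B u\<close> by at most
    \<open>f u x\<close>.\<close>
  have Xc: "\<bar>?X x - ?c\<bar> \<le> (\<Sum>u\<in>V. f u x)" if "x \<in> space M" for x
  proof -
    have "norm (?X x - ?c) \<le> (\<Sum>u\<in>V. norm (?L u x - B u))"
      using Lr AB that by (intro norm_prod_diff) (auto simp: abs_le_iff)
    also have "\<dots> \<le> (\<Sum>u\<in>V. f u x)"
    proof (rule sum_mono)
      fix u assume u: "u \<in> V"
      have "?L u x - B u = f u x * (A u - B u)" by (simp add: algebra_simps)
      moreover have "\<bar>A u - B u\<bar> \<le> 1" "0 \<le> f u x" using AB[of u] r[of u x] u that by auto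
      ultimately show "norm (?L u x - B u) \<le> f u x"
        by (simp add: abs_mult mult_left_le)
    qed
    finally show ?thesis by simp
  qed
  \<comment> \<open>The new factor is \<open>B v + (A v - B v) * f v x\<close>, so the error made by
    splitting it off is a multiple of the covariance of \<open>?X\<close> and
    \<open>f v\<close>.\<close>
  have "expectation (\<lambda>x. \<Prod>u\<in>insert v V. ?L u x) = expectation (\<lambda>x. (A v - B v) * (?X x * f v x) + B v * ?X x)"
    using insert.hyps by (intro Bochner_Integration.integral_cong) (auto simp: algebra_simps)
  also have "\<dots> = (A v - B v) * expectation (\<lambda>x. ?X x * f v x) + B v * expectation ?X"
    using iX iXf by simp
  finally have 1: "expectation (\<lambda>x. \<Prod>u\<in>insert v V. ?L u x) - ?EY * expectation ?X =
      (A v - B v) * (expectation (\<lambda>x. ?X x * f v x) - expectation ?X * expectation (f v))"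
    by (simp add: algebra_simps)
  have "\<bar>expectation (\<lambda>x. ?X x * f v x) - expectation ?X * expectation (f v)\<bar>
      \<le> expectation (\<lambda>x. (\<Sum>u\<in>V. f u x) * f v x) + expectation (\<lambda>x. \<Sum>u\<in>V. f u x) * expectation (f v)"
    using iX iXf if1 if2 Xc r[of v]
    by (intro covariance_bound[where c = ?c]) (auto simp: sum_distrib_right)
  also have "\<dots> = (\<Sum>u\<in>V. ?D u v)"
    using if1 if2 by (simp add: sum.distrib sum_distrib_right)
  finally have 2: "\<bar>expectation (\<lambda>x. ?X x * f v x) - expectation ?X * expectation (f v)\<bar> \<le> (\<Sum>u\<in>V. ?D u v)" .
  have 3: "\<bar>expectation (\<lambda>x. \<Prod>u\<in>insert v V. ?L u x) - ?EY * expectation ?X\<bar> \<le> (\<Sum>u\<in>V. ?D u v)"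
  proof -
    have "\<bar>A v - B v\<bar> \<le> 1" using AB[of v] by auto
    then show ?thesis
      unfolding 1 abs_mult using 2 by (meson abs_ge_zero mult_left_le_one_le order.trans)
  qed
  have EY: "?EY \<in> {0..1}"
    using Er[of v] AB[of v] by (intro convex_unit_range) auto
  have IH: "\<bar>expectation ?X - (\<Prod>u\<in>V. expectation (f u) * A u + (1 - expectation (f u)) * B u)\<bar>
      \<le> (\<Sum>u\<in>V. \<Sum>w\<in>V - {u}. ?D u w)" (is "\<bar>_ - ?Q\<bar> \<le> _")
    using insert.prems by (intro insert.IH) auto
  have "\<bar>?EY * expectation ?X - ?EY * ?Q\<bar> \<le> 1 * (\<Sum>u\<in>V. \<Sum>w\<in>V - {u}. ?D u w)"
    unfolding right_diff_distrib[symmetric] abs_mult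
    using IH EY by (intro mult_mono) auto
  then have "\<bar>expectation (\<lambda>x. \<Prod>u\<in>insert v V. ?L u x) - ?EY * ?Q\<bar>
      \<le> (\<Sum>u\<in>V. ?D u v) + (\<Sum>u\<in>V. \<Sum>w\<in>V - {u}. ?D u w)"
    using 3 by linarith
  also have "\<dots> = (\<Sum>u\<in>V. \<Sum>w\<in>insert v V - {u}. ?D u w)"
    unfolding sum.distrib[symmetric]
  proof (rule sum.cong[OF refl])
    fix u assume u: "u \<in> V"
    then have "insert v V - {u} = insert v (V - {u})" using insert.hyps by auto
    then show "?D u v + (\<Sum>w\<in>V - {u}. ?D u w) = (\<Sum>w\<in>insert v V - {u}. ?D u w)"
      using insert.hyps by simp
  qed
  \<comment> \<open>The pairs with first component \<open>v\<close> are added; their terms are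
    nonnegative.\<close>
  also have "\<dots> \<le> (\<Sum>u\<in>insert v V. \<Sum>w\<in>insert v V - {u}. ?D u w)"
    using insert.hyps D0 by (intro sum_mono2 sum_nonneg) auto
  finally show ?case
    using insert.hyps by simp
qed

section \<open>Decoupling the degrees\<close>

text \<open>Random points with conditional edge probabilities, abstracted from the geometry; the
  decoupling argument needs no more than this.\<close>

locale symmetric_kernel = prob_space M for M :: "'a measure" +
  fixes p :: "'a \<Rightarrow> 'a \<Rightarrow> real"
  assumes measurable_kernel: "(\<lambda>z. p (fst z) (snd z)) \<in> borel_measurable (M \<Otimes>\<^sub>M M)"
    and kernel_range: "p x y \<in> {0..1}"
    and kernel_sym: "p x y = p y x"
begin

lemma measurable_kernel' [measurable (raw)]:
  assumes "f \<in> measurable L M" "g \<in> measurable L M"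
  shows "(\<lambda>x. p (f x) (g x)) \<in> borel_measurable L"
  using measurable_compose[OF measurable_Pair[OF assms] measurable_kernel] by simp

text \<open>This is the function \<open>q\<close> of the overview.\<close>

definition edge_mean :: "'a \<Rightarrow> real" where
  "edge_mean x = (\<integral>y. p y x \<partial>M)"

definition edge_density :: real where
  "edge_density = (\<integral>x. edge_mean x \<partial>M)"

text \<open>As a second moment this is \<open>E q\<^sup>2\<close>, the probability that a random
  point is joined to both of two other random points, since edges are independent given the
  positions.\<close>

definition cherry_density :: real where
  "cherry_density = (\<integral>x. edge_mean x * edge_mean x \<partial>M)"

lemma measurable_edge_mean [measurable]: "edge_mean \<in> borel_measurable M"
  unfolding edge_mean_def by measurable

lemma edge_mean_range: "x \<in> space M \<Longrightarrow> edge_mean x \<in> {0..1}"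
  unfolding edge_mean_def using kernel_range by (intro expectation_unit_range) simp_all

lemma edge_density_range: "edge_density \<in> {0..1}"
  unfolding edge_density_def by (intro expectation_unit_range edge_mean_range) simp_all

lemma cherry_density_range: "cherry_density \<in> {0..1}"
  unfolding cherry_density_def
  using edge_mean_range by (intro expectation_unit_range) (auto intro: mult_le_one)

text \<open>The difference is the variance of \<open>edge_mean\<close>. Edges among the chosen
  vertices can thus be charged to the cherry density.\<close>

lemma edge_density_square_le: "edge_density\<^sup>2 \<le> cherry_density"
proof -
  have i: "integrable M edge_mean"
    using edge_mean_range by (intro integrable_unit_range) simp_all
  have i2: "integrable M (\<lambda>x. (edge_mean x)\<^sup>2)"
    using edge_mean_range by (intro integrable_unit_range) (auto intro: power_le_one)
  have "0 \<le> variance edge_mean" by simp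
  also have "\<dots> = cherry_density - edge_density\<^sup>2"
    using variance_eq[OF i i2] by (simp add: cherry_density_def edge_density_def power2_eq_square)
  finally show ?thesis by simp
qed

section \<open>Expectations over independent random points\<close>

lemma expectation_PiM_component:
  fixes f :: "'a \<Rightarrow> real"
  assumes "i \<in> I" and [measurable]: "f \<in> borel_measurable M"
  shows "(\<integral>x. f (x i) \<partial>(\<Pi>\<^sub>M i\<in>I. M)) = (\<integral>y. f y \<partial>M)"
proof -
  have "(\<integral>y. f y \<partial>M) = (\<integral>y. f y \<partial>(distr (\<Pi>\<^sub>M i\<in>I. M) M (\<lambda>x. x i)))"
    using assms prob_space_axioms by (subst distr_PiM_component[of I "\<lambda>_. M"]) auto
  then show ?thesis
    using assms by (simp add: integral_distr)
qed

text \<open>Coordinate \<open>i\<close> is integrated out first; what remains depends on coordinate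
  \<open>j\<close> alone.\<close>

lemma expectation_PiM_two_components:
  fixes f :: "'a \<Rightarrow> 'a \<Rightarrow> real"
  assumes "finite I" "i \<in> I" "j \<in> I" "i \<noteq> j"
    and [measurable]: "(\<lambda>z. f (fst z) (snd z)) \<in> borel_measurable (M \<Otimes>\<^sub>M M)"
    and "\<And>y z. y \<in> space M \<Longrightarrow> z \<in> space M \<Longrightarrow> f y z \<in> {0..1}"
  shows "(\<integral>x. f (x i) (x j) \<partial>(\<Pi>\<^sub>M i\<in>I. M)) = (\<integral>z. (\<integral>y. f y z \<partial>M) \<partial>M)"
proof -
  interpret P: product_sigma_finite "\<lambda>_. M"
    by unfold_locales
  interpret PI: prob_space "\<Pi>\<^sub>M i\<in>I. M"
    using prob_space_axioms by (intro prob_space_PiM)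
  have [measurable]: "(\<lambda>x. x i) \<in> measurable (\<Pi>\<^sub>M i\<in>I. M) M" "(\<lambda>x. x j) \<in> measurable (\<Pi>\<^sub>M i\<in>I. M) M"
    using assms by (auto intro: measurable_component_singleton)
  have [measurable (raw)]: "(\<lambda>x. f (g x) (h x)) \<in> borel_measurable (\<Pi>\<^sub>M i\<in>I. M)"
    if "g \<in> measurable (\<Pi>\<^sub>M i\<in>I. M) M" "h \<in> measurable (\<Pi>\<^sub>M i\<in>I. M) M" for g h
    using measurable_compose[OF measurable_Pair[OF that] assms(5)] by simp
  have int: "integrable (\<Pi>\<^sub>M i\<in>I. M) (\<lambda>x. f (x i) (x j))"
    using assms by (intro PI.integrable_unit_range) (auto simp: space_PiM PiE_mem simp del: atLeastAtMost_iff)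
  have "(\<integral>x. f (x i) (x j) \<partial>(\<Pi>\<^sub>M i\<in>I. M)) = (\<integral>x. (\<integral>y. f y (x j) \<partial>M) \<partial>(\<Pi>\<^sub>M i\<in>I - {i}. M))"
    using P.product_integral_insert[of "I - {i}" i "\<lambda>x. f (x i) (x j)"] int assms
    by (simp add: insert_absorb)
  also have "\<dots> = (\<integral>z. (\<integral>y. f y z \<partial>M) \<partial>M)"
  proof (rule expectation_PiM_component)
    have "(\<lambda>(z, y). f y z) \<in> borel_measurable (M \<Otimes>\<^sub>M M)"
      using measurable_compose[OF measurable_Pair[OF measurable_snd measurable_fst] assms(5)]
      by (simp add: case_prod_beta')
    then show "(\<lambda>z. \<integral>y. f y z \<partial>M) \<in> borel_measurable M"
      by (rule borel_measurable_lebesgue_integral)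
  qed (use assms in auto)
  finally show ?thesis .
qed

lemma expectation_kernel_PiM:
  assumes "finite I" "i \<in> I" "j \<in> I" "i \<noteq> j"
  shows "(\<integral>x. p (x i) (x j) \<partial>(\<Pi>\<^sub>M i\<in>I. M)) = edge_density"
  using assms kernel_range measurable_kernel
  by (subst expectation_PiM_two_components) (auto simp: edge_density_def edge_mean_def)

text \<open>By Fubini the ends \<open>y\<close> and \<open>z\<close> of the cherry are integrated
  before its centre \<open>x\<close>; with the symmetry of \<open>p\<close>, each of them yields a
  factor \<open>edge_mean x\<close>.\<close>

lemma cherry_density_eq:
  "(\<integral>z. (\<integral>y. (\<integral>x. p x y * p x z \<partial>M) \<partial>M) \<partial>M) = cherry_density"
proof -
  interpret PM: pair_prob_space M M ..
  have "(\<integral>y. (\<integral>x. p x y * p x z \<partial>M) \<partial>M) = (\<integral>x. edge_mean x * p x z \<partial>M)" if [simp]: "z \<in> space M" for z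
  proof -
    have "(\<integral>y. (\<integral>x. p x y * p x z \<partial>M) \<partial>M) = (\<integral>x. (\<integral>y. p x y * p x z \<partial>M) \<partial>M)"
      using kernel_range
      by (intro PM.Fubini_integral PM.integrable_unit_range)
        (auto simp: case_prod_beta' intro!: mult_le_one)
    also have "\<dots> = (\<integral>x. edge_mean x * p x z \<partial>M)"
      unfolding edge_mean_def by (intro Bochner_Integration.integral_cong refl) (simp add: kernel_sym)
    finally show ?thesis .
  qed
  then have "(\<integral>z. (\<integral>y. (\<integral>x. p x y * p x z \<partial>M) \<partial>M) \<partial>M) = (\<integral>z. (\<integral>x. edge_mean x * p x z \<partial>M) \<partial>M)"
    by (rule Bochner_Integration.integral_cong[OF refl])
  also have "\<dots> = (\<integral>x. (\<integral>z. edge_mean x * p x z \<partial>M) \<partial>M)"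
    using kernel_range edge_mean_range
    by (intro PM.Fubini_integral PM.integrable_unit_range)
      (auto simp: case_prod_beta' space_pair_measure intro!: mult_le_one)
  also have "\<dots> = cherry_density"
    unfolding cherry_density_def
    by (intro Bochner_Integration.integral_cong refl) (simp add: edge_mean_def kernel_sym)
  finally show ?thesis .
qed

text \<open>The integrand is the error term of \<open>expectation_prod_affine_diff\<close> for
  \<open>f v y = p y (x v)\<close> with \<open>x\<close> fixed; here it is averaged over the
  positions \<open>x\<close>.\<close>

lemma expectation_PiM_cherry:
  assumes "finite I" "i \<in> I" "j \<in> I" "i \<noteq> j"
  shows "(\<integral>x. (\<integral>y. p y (x i) * p y (x j) \<partial>M) + edge_mean (x i) * edge_mean (x j) \<partial>(\<Pi>\<^sub>M i\<in>I. M))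
    = cherry_density + edge_density\<^sup>2"
proof -
  interpret PI: prob_space "\<Pi>\<^sub>M i\<in>I. M"
    using prob_space_axioms by (intro prob_space_PiM)
  have m [measurable]: "(\<lambda>x. x i) \<in> measurable (\<Pi>\<^sub>M i\<in>I. M) M" "(\<lambda>x. x j) \<in> measurable (\<Pi>\<^sub>M i\<in>I. M) M"
    using assms by (auto intro: measurable_component_singleton)
  have r: "(\<integral>y. p y a * p y b \<partial>M) \<in> {0..1}" if "a \<in> space M" "b \<in> space M" for a b
    using kernel_range that by (intro expectation_unit_range) (auto intro!: mult_le_one)
  have r': "edge_mean a * edge_mean b \<in> {0..1}" if "a \<in> space M" "b \<in> space M" for a b
    using edge_mean_range that by (auto intro!: mult_le_one)
  have "(\<integral>x. (\<integral>y. p y (x i) * p y (x j) \<partial>M) + edge_mean (x i) * edge_mean (x j) \<partial>(\<Pi>\<^sub>M i\<in>I. M))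
    = (\<integral>x. (\<integral>y. p y (x i) * p y (x j) \<partial>M) \<partial>(\<Pi>\<^sub>M i\<in>I. M)) +
      (\<integral>x. edge_mean (x i) * edge_mean (x j) \<partial>(\<Pi>\<^sub>M i\<in>I. M))"
    using assms
    by (intro Bochner_Integration.integral_add PI.integrable_unit_range r r')
      (auto simp: space_PiM)
  also have "(\<integral>x. (\<integral>y. p y (x i) * p y (x j) \<partial>M) \<partial>(\<Pi>\<^sub>M i\<in>I. M)) = cherry_density"
    using r assms by (subst expectation_PiM_two_components) (auto simp: cherry_density_eq simp del: atLeastAtMost_iff)
  also have "(\<integral>x. edge_mean (x i) * edge_mean (x j) \<partial>(\<Pi>\<^sub>M i\<in>I. M)) = edge_density\<^sup>2"
    using r' assms
    by (subst expectation_PiM_two_components)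
      (auto simp: edge_density_def power2_eq_square simp del: atLeastAtMost_iff)
  finally show ?thesis .
qed

text \<open>
  Here \<open>(resample ^^ n) g x 0\<close> is the mean of \<open>g x\<close> at a binomial variable with parameters \<open>n\<close> and
  \<open>edge_mean x\<close>.
\<close>

definition resample :: "('a \<Rightarrow> nat \<Rightarrow> real) \<Rightarrow> 'a \<Rightarrow> nat \<Rightarrow> real" where
  "resample g x n = edge_mean x * g x (Suc n) + (1 - edge_mean x) * g x n"

lemma measurable_resample:
  "(\<And>n. (\<lambda>x. g x n) \<in> borel_measurable M) \<Longrightarrow> (\<lambda>x. resample g x n) \<in> borel_measurable M"
  unfolding resample_def by simp

lemma resample_range:
  "(\<And>n. g x n \<in> {0..1}) \<Longrightarrow> x \<in> space M \<Longrightarrow> resample g x n \<in> {0..1}"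
  unfolding resample_def by (intro convex_unit_range edge_mean_range)

text \<open>
  The vertices of \<open>W\<close> are processed one at a time: each is made to choose its neighbours in \<open>V\<close>
  independently, at the cost of the probability that it has two neighbours there.
\<close>

lemma count_means_near_independent:
  fixes g :: "'i \<Rightarrow> 'a \<Rightarrow> nat \<Rightarrow> real"
  assumes "finite W" "finite K" "K \<inter> W = {}" "V \<subseteq> K"
    and "\<And>v n. v \<in> V \<Longrightarrow> (\<lambda>x. g v x n) \<in> borel_measurable M"
    and "\<And>v x n. v \<in> V \<Longrightarrow> x \<in> space M \<Longrightarrow> g v x n \<in> {0..1}"
  shows "\<bar>(\<integral>x. (\<Prod>v\<in>V. bernoulli_count_mean W (\<lambda>w. p (x w) (x v)) (g v (x v))) \<partial>(\<Pi>\<^sub>M i\<in>K \<union> W. M))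
      - (\<Prod>v\<in>V. \<integral>x. (resample ^^ card W) (g v) x 0 \<partial>M)\<bar>
    \<le> card W * ((card V)\<^sup>2 * (cherry_density + edge_density\<^sup>2))"
  using assms
proof (induction W arbitrary: g rule: finite_induct)
  case empty
  interpret P: product_sigma_finite "\<lambda>_. M"
    by unfold_locales
  \<comment> \<open>Factors 1 are placed on \<open>K - V\<close> so that the product runs over all
    coordinates and the integral factorises.\<close>
  let ?f = "\<lambda>v x. if v \<in> V then g v x 0 else 1"
  have V: "finite V" "K \<inter> V = V" using empty by (auto intro: finite_subset)
  have eq: "(\<Prod>v\<in>V. h v) = (\<Prod>v\<in>K. if v \<in> V then h v else 1)" for h :: "'i \<Rightarrow> real"
    using empty V by (simp add: prod.inter_restrict[symmetric])
  have "(\<integral>x. (\<Prod>v\<in>V. g v (x v) 0) \<partial>(\<Pi>\<^sub>M i\<in>K. M)) = (\<integral>x. (\<Prod>v\<in>K. ?f v (x v)) \<partial>(\<Pi>\<^sub>M i\<in>K. M))"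
    by (simp add: eq)
  also have "\<dots> = (\<Prod>v\<in>K. \<integral>x. ?f v x \<partial>M)"
  proof (rule P.product_integral_prod)
    show "integrable M (?f v)" if "v \<in> K" for v
      using empty by (cases "v \<in> V") (auto intro!: integrable_unit_range simp del: atLeastAtMost_iff)
  qed (use empty in auto)
  also have "\<dots> = (\<Prod>v\<in>V. \<integral>x. g v x 0 \<partial>M)"
    unfolding eq by (intro prod.cong) (auto simp: prob_space)
  finally show ?case by simp
next
  case (insert w W)
  interpret P: product_sigma_finite "\<lambda>_. M"
    by unfold_locales
  let ?I = "K \<union> W"
  let ?PI = "\<Pi>\<^sub>M i\<in>?I. M"
  interpret PI: prob_space ?PI
    using prob_space_axioms by (intro prob_space_PiM)
  interpret PI': prob_space "\<Pi>\<^sub>M i\<in>insert w ?I. M"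
    using prob_space_axioms by (intro prob_space_PiM)
  have fin: "finite ?I" "w \<notin> ?I" "finite V"
    using insert by (auto intro: finite_subset)
  have sp: "x v \<in> space M" if "x \<in> space ?PI" "v \<in> ?I" for x v
    using that by (auto simp: space_PiM)
  have sp': "x v \<in> space M" if "x \<in> space (\<Pi>\<^sub>M i\<in>insert w ?I. M)" "v \<in> insert w ?I" for x v
    using that by (auto simp: space_PiM)
  have comp: "(\<lambda>x. x v) \<in> measurable ?PI M" if "v \<in> ?I" for v
    using that by (rule measurable_component_singleton)
  have comp': "(\<lambda>x. x v) \<in> measurable (\<Pi>\<^sub>M i\<in>insert w ?I. M) M" if "v \<in> insert w ?I" for v
    using that by (rule measurable_component_singleton)
  have gm: "(\<lambda>x. g v x n) \<in> borel_measurable M" if "v \<in> V" for v n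
    using insert that by auto
  have gr: "g v x n \<in> {0..1}" if "v \<in> V" "x \<in> space M" for v n x
    using insert.prems that by auto
  have VI: "v \<in> ?I" if "v \<in> V" for v
    using insert.prems that by auto
  let ?F = "\<lambda>W x v h. bernoulli_count_mean W (\<lambda>w. p (x w) (x v)) h"
  let ?f = "\<lambda>x. \<Prod>v\<in>V. ?F (insert w W) x v (g v (x v))"
  let ?h = "\<lambda>x. \<Prod>v\<in>V. ?F W x v (resample (g v) (x v))"
  \<comment> \<open>Count means at \<open>v\<close> given that \<open>w\<close> is a neighbour of
    \<open>v\<close> (\<open>?A\<close>) or is not (\<open>?B\<close>).\<close>
  let ?A = "\<lambda>x v. ?F W x v (\<lambda>n. g v (x v) (Suc n))" and ?B = "\<lambda>x v. ?F W x v (g v (x v))"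
  let ?E = "\<lambda>x u v. (\<integral>y. p y (x u) * p y (x v) \<partial>M) + edge_mean (x u) * edge_mean (x v)"
  let ?\<delta> = "cherry_density + edge_density\<^sup>2"
  have fm: "?f \<in> borel_measurable (\<Pi>\<^sub>M i\<in>insert w ?I. M)"
    using VI gm
    by (intro borel_measurable_prod borel_measurable_bernoulli_count_mean measurable_kernel'
        comp' measurable_compose[OF comp']) auto
  have hm: "?h \<in> borel_measurable ?PI"
    using VI gm
    by (intro borel_measurable_prod borel_measurable_bernoulli_count_mean measurable_kernel'
        comp measurable_compose[OF comp measurable_resample]) auto
  have Fr: "?F W' x v (h v) \<in> {0..1}" if "finite W'" "\<And>n. h v n \<in> {0..1}" for x v W' and h :: "'i \<Rightarrow> nat \<Rightarrow> real"
    using that kernel_range by (intro bernoulli_count_mean_range)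
  have fi: "integrable (\<Pi>\<^sub>M i\<in>insert w ?I. M) ?f"
    using fm insert.hyps VI
    by (intro PI'.integrable_unit_range prod_unit_range Fr gr sp') auto
  have hi: "integrable ?PI ?h"
    using hm insert.hyps VI
    by (intro PI.integrable_unit_range prod_unit_range Fr resample_range gr sp) auto
  \<comment> \<open>Only the trial of \<open>w\<close> involves \<open>y\<close>, so each factor is
    affine in \<open>p y (x v)\<close>.\<close>
  have step: "(\<integral>y. ?f (x(w := y)) \<partial>M) = (\<integral>y. (\<Prod>v\<in>V. p y (x v) * ?A x v + (1 - p y (x v)) * ?B x v) \<partial>M)" for x
  proof (intro Bochner_Integration.integral_cong refl prod.cong)
    fix y v assume v: "v \<in> V"
    then have "v \<noteq> w" using fin(2) VI by auto
    moreover have "?F W (x(w := y)) v h = ?F W x v h" for h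
      using insert.hyps \<open>v \<noteq> w\<close> by (intro bernoulli_count_mean_cong) auto
    ultimately show "?F (insert w W) (x(w := y)) v (g v ((x(w := y)) v)) =
        p y (x v) * ?A x v + (1 - p y (x v)) * ?B x v"
      using insert.hyps by (subst bernoulli_count_mean_insert) auto
  qed
  \<comment> \<open>Resampling commutes with the count mean, so \<open>?h\<close> has the form of
    the integrand in \<open>step\<close> with every \<open>p y (x v)\<close> replaced by its mean
    over \<open>y\<close>.\<close>
  have h_eq: "?h x = (\<Prod>v\<in>V. edge_mean (x v) * ?A x v + (1 - edge_mean (x v)) * ?B x v)" for x
    by (intro prod.cong refl) (simp add: resample_def[abs_def] bernoulli_count_mean_affine)
  have bound: "\<bar>(\<integral>y. ?f (x(w := y)) \<partial>M) - ?h x\<bar> \<le> (\<Sum>u\<in>V. \<Sum>v\<in>V - {u}. ?E x u v)" if "x \<in> space ?PI" for x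
    unfolding step h_eq unfolding edge_mean_def
    using that fin(3) insert.hyps kernel_range sp VI
    by (intro expectation_prod_affine_diff Fr gr) auto
  have iE: "integrable ?PI (\<lambda>x. ?E x u v)" if "u \<in> V" "v \<in> V" for u v
  proof -
    have [measurable]: "(\<lambda>x. x u) \<in> measurable ?PI M" "(\<lambda>x. x v) \<in> measurable ?PI M"
      using comp VI that by auto
    show ?thesis
      using sp VI that edge_mean_range kernel_range
      by (intro Bochner_Integration.integrable_add PI.integrable_unit_range expectation_unit_range)
        (auto intro!: mult_le_one simp: expectation_unit_range)
  qed
  have fint: "(\<integral>x. ?f x \<partial>(\<Pi>\<^sub>M i\<in>insert w ?I. M)) = (\<integral>x. (\<integral>y. ?f (x(w := y)) \<partial>M) \<partial>?PI)"
    using fin fi by (rule_tac P.product_integral_insert) auto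
  have fi': "integrable ?PI (\<lambda>x. \<integral>y. ?f (x(w := y)) \<partial>M)"
  proof (rule PI.integrable_unit_range)
    have "(\<lambda>(x, y). ?f (x(w := y))) \<in> borel_measurable (?PI \<Otimes>\<^sub>M M)"
      using measurable_compose[OF measurable_add_dim fm] by (simp add: case_prod_beta')
    then show "(\<lambda>x. \<integral>y. ?f (x(w := y)) \<partial>M) \<in> borel_measurable ?PI"
      by (rule borel_measurable_lebesgue_integral)
    fix x assume x: "x \<in> space ?PI"
    show "(\<integral>y. ?f (x(w := y)) \<partial>M) \<in> {0..1}"
      unfolding step
      using x insert.hyps sp VI kernel_range comp
      by (intro expectation_unit_range prod_unit_range convex_unit_range Fr gr) auto
  qed
  have "\<bar>(\<integral>x. (\<integral>y. ?f (x(w := y)) \<partial>M) \<partial>?PI) - (\<integral>x. ?h x \<partial>?PI)\<bar>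
      = \<bar>\<integral>x. (\<integral>y. ?f (x(w := y)) \<partial>M) - ?h x \<partial>?PI\<bar>"
    using fi' hi by (subst Bochner_Integration.integral_diff) auto
  also have "\<dots> \<le> (\<integral>x. (\<Sum>u\<in>V. \<Sum>v\<in>V - {u}. ?E x u v) \<partial>?PI)"
    by (rule order.trans[OF integral_abs_bound integral_mono])
      (use bound iE fi' hi in \<open>auto intro!: Bochner_Integration.integrable_sum simp del: Bochner_Integration.integrable_add\<close>)
  also have "\<dots> = (\<Sum>u\<in>V. \<Sum>v\<in>V - {u}. \<integral>x. ?E x u v \<partial>?PI)"
    using iE by (subst Bochner_Integration.integral_sum, force)
      (intro sum.cong refl Bochner_Integration.integral_sum, force)
  also have "\<dots> = (\<Sum>u\<in>V. \<Sum>v\<in>V - {u}. ?\<delta>)"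
    using fin VI by (intro sum.cong refl expectation_PiM_cherry) auto
  \<comment> \<open>Diagonal pairs are added to reach the closed form
    \<open>(card V)\<^sup>2\<close>.\<close>
  also have "\<dots> \<le> (\<Sum>u\<in>V. \<Sum>v\<in>V. ?\<delta>)"
    using fin cherry_density_range by (intro sum_mono sum_mono2) auto
  also have "\<dots> = (card V)\<^sup>2 * ?\<delta>"
    by (simp add: power2_eq_square)
  finally have 1: "\<bar>(\<integral>x. ?f x \<partial>(\<Pi>\<^sub>M i\<in>insert w ?I. M)) - (\<integral>x. ?h x \<partial>?PI)\<bar> \<le> (card V)\<^sup>2 * ?\<delta>"
    unfolding fint .
  \<comment> \<open>The independent choices of \<open>w\<close> are now part of the test functions:
    the induction hypothesis is applied to \<open>resample (g v)\<close>.\<close>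
  have 2: "\<bar>(\<integral>x. ?h x \<partial>?PI) - (\<Prod>v\<in>V. \<integral>x. (resample ^^ card W) (resample (g v)) x 0 \<partial>M)\<bar>
      \<le> card W * ((card V)\<^sup>2 * ?\<delta>)"
    using insert.prems gm gr by (intro insert.IH measurable_resample resample_range) auto
  have "(resample ^^ card (insert w W)) (g v) = (resample ^^ card W) (resample (g v))" for v
    using insert.hyps by (simp add: funpow_swap1)
  moreover have "real (card (insert w W)) * c = c + card W * c" for c :: real
    using insert.hyps by (simp add: algebra_simps)
  ultimately show ?case
    using 1 2 by (simp only: Un_insert_right)
qed

end

section \<open>Degrees in the random graph\<close>

text \<open>Edges of the model are indexed by increasing pairs; this is the index of the edge
  between two vertices given in either order.\<close>

definition pair_of :: "nat \<Rightarrow> nat \<Rightarrow> nat \<times> nat" where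
  "pair_of u v = (min u v, max u v)"

lemma pair_of_in_vertex_pairs: "u < N \<Longrightarrow> v < N \<Longrightarrow> u \<noteq> v \<Longrightarrow> pair_of u v \<in> vertex_pairs N"
  by (auto simp: pair_of_def vertex_pairs_def min_def max_def)

text \<open>The law of the edge indicators given the positions, with arbitrary probabilities
  \<open>t\<close> in place of those computed from the positions.\<close>

definition edge_pmf :: "nat \<Rightarrow> (nat \<Rightarrow> nat \<Rightarrow> real) \<Rightarrow> (nat \<times> nat \<Rightarrow> bool) pmf" where
  "edge_pmf N t = Pi_pmf (vertex_pairs N) False (\<lambda>(u, v). bernoulli_pmf (t u v))"

text \<open>\<open>V\<close> and \<open>W\<close> are disjoint, so the pairs between them are
  distinct and their edges independent. The sum over all choices of neighbourhoods in
  \<open>W\<close> then factorises over \<open>V\<close>.\<close>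

lemma prob_star_counts:
  fixes t :: "nat \<Rightarrow> nat \<Rightarrow> real"
  assumes "W \<subseteq> {..<N}" "V \<subseteq> {..<N}" "V \<inter> W = {}"
    and t: "\<And>u v. t u v \<in> {0..1}" "\<And>u v. t u v = t v u"
  shows "measure_pmf.prob (edge_pmf N t) {\<omega>. \<forall>v\<in>V. card {w\<in>W. \<omega> (pair_of w v)} = k v}
    = (\<Prod>v\<in>V. bernoulli_count_mean W (\<lambda>w. t w v) (\<lambda>n. of_bool (n = k v)))"
proof -
  have fin: "finite W" "finite V"
    using assms by (auto intro: finite_subset)
  \<comment> \<open>\<open>E S\<close> prescribes the neighbourhood \<open>S v\<close> in
    \<open>W\<close> of every \<open>v\<close>. \<open>B S d\<close> is the constraint that this
    puts on the single coordinate \<open>d\<close>, which exhibits \<open>E S\<close> as a product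
    set.\<close>
  define E where "E S = {\<omega>. \<forall>v\<in>V. \<forall>w\<in>W. \<omega> (pair_of w v) = (w \<in> S v)}" for S :: "nat \<Rightarrow> nat set"
  define B where "B S d = {b. \<forall>v\<in>V. \<forall>w\<in>W. d = pair_of w v \<longrightarrow> b = (w \<in> S v)}" for S :: "nat \<Rightarrow> nat set" and d
  \<comment> \<open>Families of neighbourhoods with the required sizes, taken extensional so that
    distinct ones give disjoint events.\<close>
  define T where "T = (\<Pi>\<^sub>E v\<in>V. {S\<in>Pow W. card S = k v})"
  let ?f = "\<lambda>v S w. if w \<in> S then t w v else 1 - t w v"
  have vp: "pair_of w v \<in> vertex_pairs N" if "w \<in> W" "v \<in> V" for w v
    using that assms by (intro pair_of_in_vertex_pairs) auto
  have inj: "inj_on (\<lambda>(v, w). pair_of w v) (V \<times> W)"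
    using assms by (auto simp: inj_on_def pair_of_def min_def max_def split: if_splits)
  have pE: "measure_pmf.prob (edge_pmf N t) (E S) = (\<Prod>v\<in>V. \<Prod>w\<in>W. ?f v (S v) w)" for S
  proof -
    have "E S = Pi (vertex_pairs N) (B S)"
    proof (intro equalityI subsetI)
      fix \<omega> assume \<omega>: "\<omega> \<in> Pi (vertex_pairs N) (B S)"
      have "\<omega> (pair_of w v) \<in> B S (pair_of w v)" if "v \<in> V" "w \<in> W" for v w
        using \<omega> vp[OF that(2,1)] by blast
      then show "\<omega> \<in> E S" by (auto simp: E_def B_def)
    qed (auto simp: E_def B_def)
    then have "measure_pmf.prob (edge_pmf N t) (E S) =
        (\<Prod>d\<in>vertex_pairs N. measure_pmf.prob ((\<lambda>(u, v). bernoulli_pmf (t u v)) d) (B S d))"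
      unfolding edge_pmf_def by (simp add: measure_Pi_pmf_Pi finite_vertex_pairs)
    \<comment> \<open>Pairs that do not join \<open>V\<close> to \<open>W\<close> are unconstrained
      and contribute the factor 1.\<close>
    also have "\<dots> = (\<Prod>d\<in>(\<lambda>(v, w). pair_of w v) ` (V \<times> W). measure_pmf.prob ((\<lambda>(u, v). bernoulli_pmf (t u v)) d) (B S d))"
    proof (rule prod.mono_neutral_right)
      show "\<forall>d\<in>vertex_pairs N - (\<lambda>(v, w). pair_of w v) ` (V \<times> W).
          measure_pmf.prob ((\<lambda>(u, v). bernoulli_pmf (t u v)) d) (B S d) = 1"
      proof
        fix d assume "d \<in> vertex_pairs N - (\<lambda>(v, w). pair_of w v) ` (V \<times> W)"
        then have "B S d = UNIV" by (auto simp: B_def)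
        then show "measure_pmf.prob ((\<lambda>(u, v). bernoulli_pmf (t u v)) d) (B S d) = 1" by simp
      qed
    qed (use vp finite_vertex_pairs in auto)
    also have "\<dots> = (\<Prod>(v, w)\<in>V \<times> W. ?f v (S v) w)"
      unfolding prod.reindex[OF inj] o_def
    proof (rule prod.cong[OF refl], clarify)
      fix v w assume vw: "v \<in> V" "w \<in> W"
      \<comment> \<open>Exactly one constraint falls on this coordinate, because the indexing of
        pairs is injective.\<close>
      have "(v, w) = (v', w')" if "pair_of w v = pair_of w' v'" "v' \<in> V" "w' \<in> W" for v' w'
        using inj_onD[OF inj, of "(v, w)" "(v', w')"] that vw by auto
      then have "B S (pair_of w v) = {w \<in> S v}"
        using vw by (auto simp: B_def)
      moreover have "(\<lambda>(u, v). bernoulli_pmf (t u v)) (pair_of w v) = bernoulli_pmf (t w v)"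
        using t(2)[of w v] by (auto simp: pair_of_def min_def max_def)
      ultimately show "measure_pmf.prob ((\<lambda>(u, v). bernoulli_pmf (t u v)) (pair_of w v)) (B S (pair_of w v)) = ?f v (S v) w"
        using t(1)[of w v] by (auto simp: measure_pmf_single)
    qed
    finally show ?thesis by (simp add: prod.cartesian_product)
  qed
  have "{\<omega>. \<forall>v\<in>V. card {w\<in>W. \<omega> (pair_of w v)} = k v} = (\<Union>S\<in>T. E S)"
  proof (intro equalityI subsetI)
    fix \<omega> assume "\<omega> \<in> {\<omega>. \<forall>v\<in>V. card {w\<in>W. \<omega> (pair_of w v)} = k v}"
    then have "(\<lambda>v\<in>V. {w\<in>W. \<omega> (pair_of w v)}) \<in> T" "\<omega> \<in> E (\<lambda>v\<in>V. {w\<in>W. \<omega> (pair_of w v)})"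
      by (auto simp: T_def E_def)
    then show "\<omega> \<in> (\<Union>S\<in>T. E S)" by blast
  next
    fix \<omega> assume "\<omega> \<in> (\<Union>S\<in>T. E S)"
    then obtain S where S: "S \<in> T" "\<omega> \<in> E S" by blast
    have "{w\<in>W. \<omega> (pair_of w v)} = S v" if "v \<in> V" for v
      using S that by (auto simp: T_def E_def PiE_def Pi_def)
    then show "\<omega> \<in> {\<omega>. \<forall>v\<in>V. card {w\<in>W. \<omega> (pair_of w v)} = k v}"
      using S by (auto simp: T_def PiE_def Pi_def)
  qed
  moreover have "disjoint_family_on E T"
  proof -
    have "S = S'" if "S \<in> T" "S' \<in> T" "\<omega> \<in> E S" "\<omega> \<in> E S'" for S S' \<omega>
    proof (rule PiE_ext[where k = V])
      fix v assume "v \<in> V"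
      then have "S v \<subseteq> W" "S' v \<subseteq> W" "\<forall>w\<in>W. w \<in> S v \<longleftrightarrow> w \<in> S' v"
        using that by (auto simp: T_def E_def PiE_def Pi_def)
      then show "S v = S' v" by blast
    qed (use that in \<open>auto simp: T_def\<close>)
    then show ?thesis by (fastforce simp: disjoint_family_on_def)
  qed
  moreover have "finite T"
    using fin by (auto simp: T_def intro!: finite_PiE)
  ultimately have "measure_pmf.prob (edge_pmf N t) {\<omega>. \<forall>v\<in>V. card {w\<in>W. \<omega> (pair_of w v)} = k v}
      = (\<Sum>S\<in>T. \<Prod>v\<in>V. \<Prod>w\<in>W. ?f v (S v) w)"
    by (simp add: measure_pmf.finite_measure_finite_Union pE)
  also have "\<dots> = (\<Prod>v\<in>V. \<Sum>S\<in>{S\<in>Pow W. card S = k v}. \<Prod>w\<in>W. ?f v S w)"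
    unfolding T_def using fin by (subst prod_sum_PiE) auto
  also have "\<dots> = (\<Prod>v\<in>V. bernoulli_count_mean W (\<lambda>w. t w v) (\<lambda>n. of_bool (n = k v)))"
    unfolding bernoulli_count_mean_def
    using fin by (intro prod.cong refl sum.mono_neutral_cong_left) auto
  finally show ?thesis .
qed

lemma edge_pmf_edge:
  assumes "\<And>u v. t u v \<in> {0..1}" "\<And>u v. t u v = t v u" "u < N" "v < N" "u \<noteq> v"
  shows "measure_pmf.prob (edge_pmf N t) {\<omega>. \<omega> (pair_of u v)} = t u v"
proof -
  have "measure_pmf.prob (edge_pmf N t) {\<omega>. \<omega> (pair_of u v)} =
      measure_pmf.prob (map_pmf (\<lambda>\<omega>. \<omega> (pair_of u v)) (edge_pmf N t)) {True}"
    by (simp add: vimage_def)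
  also have "map_pmf (\<lambda>\<omega>. \<omega> (pair_of u v)) (edge_pmf N t) = bernoulli_pmf (t u v)"
    unfolding edge_pmf_def
    using assms(2)[of u v] pair_of_in_vertex_pairs[OF assms(3,4,5)] finite_vertex_pairs
    by (subst Pi_pmf_component) (auto simp: pair_of_def min_def max_def)
  finally show ?thesis
    using assms(1)[of u v] by (simp add: measure_pmf_single)
qed

text \<open>On the support of \<open>edge_pmf\<close> all indicators outside
  \<open>vertex_pairs N\<close> have the default value \<open>False\<close>, which excludes loops
  and decreasing pairs.\<close>

lemma graph_degree_edges:
  assumes "\<omega> \<in> set_pmf (edge_pmf N t)" "v < N"
  shows "graph_degree {{a, b} | a b. \<omega> (a, b)} v = card {u\<in>{..<N} - {v}. \<omega> (pair_of u v)}"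
proof -
  have lt: "a < b \<and> b < N" if "\<omega> (a, b)" for a b
    using that assms(1) set_Pi_pmf_subset[OF finite_vertex_pairs, of N False "\<lambda>(u, v). bernoulli_pmf (t u v)"]
    by (force simp: edge_pmf_def vertex_pairs_def)
  have "({u, v} \<in> {{a, b} | a b. \<omega> (a, b)}) = (u \<in> {..<N} - {v} \<and> \<omega> (pair_of u v))" for u
  proof (cases u v rule: linorder_cases)
    case less
    then show ?thesis
      using assms(2) lt[of v u] by (auto simp: pair_of_def doubleton_eq_iff)
  next
    case equal
    then show ?thesis
      using lt by (auto simp: doubleton_eq_iff)
  next
    case greater
    then show ?thesis
      using lt[of u v] lt[of v u] by (auto simp: pair_of_def doubleton_eq_iff)
  qed
  then show ?thesis
    unfolding graph_degree_def by (intro arg_cong[where f = card]) auto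
qed

text \<open>The degree of \<open>v\<close> differs from its number of neighbours in \<open>W\<close>
  only if \<open>v\<close> has a neighbour in \<open>K\<close>; the right-hand side is the union
  bound for this event.\<close>

lemma prob_degrees_diff:
  fixes t :: "nat \<Rightarrow> nat \<Rightarrow> real"
  assumes K: "K \<union> W = {..<N}" "K \<inter> W = {}" "V \<subseteq> K"
    and t: "\<And>u v. t u v \<in> {0..1}" "\<And>u v. t u v = t v u"
  shows "\<bar>measure_pmf.prob (edge_pmf N t) {\<omega>. \<forall>v\<in>V. graph_degree {{a, b} | a b. \<omega> (a, b)} v = k v}
      - (\<Prod>v\<in>V. bernoulli_count_mean W (\<lambda>w. t w v) (\<lambda>n. of_bool (n = k v)))\<bar>
    \<le> (\<Sum>v\<in>V. \<Sum>u\<in>K - {v}. t u v)"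
proof -
  let ?P = "edge_pmf N t"
  let ?A = "{\<omega>. \<forall>v\<in>V. graph_degree {{a, b} | a b. \<omega> (a, b)} v = k v}"
  let ?B = "{\<omega>. \<forall>v\<in>V. card {w\<in>W. \<omega> (pair_of w v)} = k v}"
  let ?C = "\<Union>v\<in>V. \<Union>u\<in>K - {v}. {\<omega>. \<omega> (pair_of u v)}"
  have K': "K \<subseteq> {..<N}" "W \<subseteq> {..<N}" using K by auto
  have "finite K" using K'(1) by (rule finite_subset) simp
  then have fin: "finite K" "finite V" using K(3) by (auto intro: finite_subset)
  have same: "\<omega> \<in> ?A \<longleftrightarrow> \<omega> \<in> ?B" if "\<omega> \<in> set_pmf ?P" "\<omega> \<notin> ?C" for \<omega>
  proof -
    have "graph_degree {{a, b} | a b. \<omega> (a, b)} v = card {w\<in>W. \<omega> (pair_of w v)}" if v: "v \<in> V" for v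
    proof -
      have "v < N" using v K K' by auto
      moreover have "{u\<in>{..<N} - {v}. \<omega> (pair_of u v)} = {w\<in>W. \<omega> (pair_of w v)}"
        using \<open>\<omega> \<notin> ?C\<close> v K by blast
      ultimately show ?thesis
        using graph_degree_edges[OF \<open>\<omega> \<in> set_pmf ?P\<close>] by simp
    qed
    then show ?thesis by simp
  qed
  have C: "measure_pmf.prob ?P ?C \<le> (\<Sum>v\<in>V. \<Sum>u\<in>K - {v}. t u v)"
  proof -
    have "measure_pmf.prob ?P ?C \<le> (\<Sum>v\<in>V. measure_pmf.prob ?P (\<Union>u\<in>K - {v}. {\<omega>. \<omega> (pair_of u v)}))"
      using fin by (intro measure_pmf.finite_measure_subadditive_finite) auto
    also have "\<dots> \<le> (\<Sum>v\<in>V. \<Sum>u\<in>K - {v}. measure_pmf.prob ?P {\<omega>. \<omega> (pair_of u v)})"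
      using fin by (intro sum_mono measure_pmf.finite_measure_subadditive_finite) auto
    also have "\<dots> = (\<Sum>v\<in>V. \<Sum>u\<in>K - {v}. t u v)"
      using K K' t by (intro sum.cong refl edge_pmf_edge) auto
    finally show ?thesis .
  qed
  have "measure_pmf.prob ?P ?A \<le> measure_pmf.prob ?P (?B \<union> ?C)"
    using same by (intro measure_pmf.finite_measure_mono_AE) (auto simp: AE_measure_pmf_iff)
  also have "\<dots> \<le> measure_pmf.prob ?P ?B + measure_pmf.prob ?P ?C"
    by (rule measure_Un_le) auto
  finally have 1: "measure_pmf.prob ?P ?A \<le> measure_pmf.prob ?P ?B + measure_pmf.prob ?P ?C" .
  have "measure_pmf.prob ?P ?B \<le> measure_pmf.prob ?P (?A \<union> ?C)"
    using same by (intro measure_pmf.finite_measure_mono_AE) (auto simp: AE_measure_pmf_iff)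
  also have "\<dots> \<le> measure_pmf.prob ?P ?A + measure_pmf.prob ?P ?C"
    by (rule measure_Un_le) auto
  finally have 2: "measure_pmf.prob ?P ?B \<le> measure_pmf.prob ?P ?A + measure_pmf.prob ?P ?C" .
  have "measure_pmf.prob ?P ?B = (\<Prod>v\<in>V. bernoulli_count_mean W (\<lambda>w. t w v) (\<lambda>n. of_bool (n = k v)))"
    using K K' t by (intro prob_star_counts) auto
  then show ?thesis using 1 2 C by linarith
qed

section \<open>Averaging over the vertex positions\<close>

lemma edge_prob_sym: "edge_prob \<zeta> \<beta> R x y = edge_prob \<zeta> \<beta> R y x"
  by (simp add: edge_prob_def hyp_dist_def rel_angle_def abs_minus_commute mult.commute)

lemma symmetric_kernel_edge_prob:
  assumes "0 < \<alpha>" "0 < R"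
  shows "symmetric_kernel (point_measure_hyp \<alpha> R) (edge_prob \<zeta> \<beta> R)"
proof -
  interpret prob_space "point_measure_hyp \<alpha> R"
    using assms by (rule prob_space_point_measure_hyp)
  have "sets (point_measure_hyp \<alpha> R \<Otimes>\<^sub>M point_measure_hyp \<alpha> R) = sets (borel \<Otimes>\<^sub>M borel)"
    by (intro sets_pair_measure_cong sets_point_measure_hyp)
  then show ?thesis
    using measurable_edge_prob edge_prob_range edge_prob_sym
    by unfold_locales (auto cong: measurable_cong_sets)
qed

lemma graph_given_positions_eq:
  "graph_given_positions \<zeta> \<beta> N x = map_pmf (\<lambda>\<omega>. {{u, v} | u v. \<omega> (u, v)})
     (edge_pmf N (\<lambda>u v. edge_prob \<zeta> \<beta> (hyp_radius \<zeta> N) (x u) (x v)))"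
  by (simp add: graph_given_positions_def edge_pmf_def)

text \<open>The positions are averaged out of \<open>prob_degrees_diff\<close>, and
  \<open>count_means_near_independent\<close> is applied to the result. The factor at
  \<open>v\<close> depends on \<open>card W\<close> but not on the choice of \<open>V\<close> inside
  \<open>K\<close>, so the same factors serve \<open>V = K\<close> and single vertices.\<close>

lemma degrees_near_product:
  fixes \<zeta> \<alpha> \<beta> :: real
  assumes "0 < \<zeta>" "0 < \<alpha>" "2 \<le> N"
    and K: "K \<union> W = {..<N}" "K \<inter> W = {}" "V \<subseteq> K"
  defines "M \<equiv> point_measure_hyp \<alpha> (hyp_radius \<zeta> N)" and "p \<equiv> edge_prob \<zeta> \<beta> (hyp_radius \<zeta> N)"
  shows "\<bar>measure (hyp_random_graph N \<zeta> \<alpha> \<beta>) {G. \<forall>v\<in>V. graph_degree G v = k v}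
      - (\<Prod>v\<in>V. \<integral>x. (symmetric_kernel.resample M p ^^ card W) (\<lambda>_ n. of_bool (n = k v)) x 0 \<partial>M)\<bar>
    \<le> (card K)\<^sup>2 * (symmetric_kernel.edge_density M p
        + N * (symmetric_kernel.cherry_density M p + (symmetric_kernel.edge_density M p)\<^sup>2))"
proof -
  have R: "0 < hyp_radius \<zeta> N" using assms by (simp add: hyp_radius_def)
  interpret symmetric_kernel M p
    unfolding M_def p_def using assms(2) R by (rule symmetric_kernel_edge_prob)
  let ?P = "positions \<zeta> \<alpha> N"
  interpret P: prob_space ?P
    using assms by (intro prob_space_positions)
  have P: "?P = (\<Pi>\<^sub>M i\<in>K \<union> W. M)"
    by (simp add: positions_def M_def K)
  have fin: "finite K" "finite W" "finite V"
    using K by (metis finite_Un finite_lessThan finite_subset)+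
  have comp: "(\<lambda>x. x v) \<in> measurable ?P M" if "v \<in> K \<union> W" for v
    unfolding P using that by (rule measurable_component_singleton)
  let ?D = "{G. \<forall>v\<in>V. graph_degree G v = k v}"
  let ?f = "\<lambda>x. measure (measure_pmf (graph_given_positions \<zeta> \<beta> N x)) ?D"
  let ?h = "\<lambda>x. \<Prod>v\<in>V. bernoulli_count_mean W (\<lambda>w. p (x w) (x v)) (\<lambda>n. of_bool (n = k v))"
  let ?s = "\<lambda>x. \<Sum>v\<in>V. \<Sum>u\<in>K - {v}. p (x u) (x v)"
  let ?\<delta> = "cherry_density + edge_density\<^sup>2"
  have meas: "measure (hyp_random_graph N \<zeta> \<alpha> \<beta>) ?D = (\<integral>x. ?f x \<partial>?P)"
    unfolding hyp_random_graph_def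
    by (rule P.measure_bind[OF measurable_graph_given_positions]) simp
  have diff: "\<bar>?f x - ?h x\<bar> \<le> ?s x" for x
    using prob_degrees_diff[OF K, of "\<lambda>u v. p (x u) (x v)" k] kernel_range kernel_sym
    by (simp add: graph_given_positions_eq p_def vimage_def)
  have fi: "integrable ?P ?f"
  proof (rule P.integrable_unit_range)
    have "(\<lambda>M. measure M ?D) \<in> borel_measurable (subprob_algebra (count_space UNIV))"
      by (rule measurable_measure_subprob_algebra) simp
    then show "?f \<in> borel_measurable ?P"
      by (rule measurable_compose[OF measurable_graph_given_positions])
  qed simp
  have hi: "integrable ?P ?h"
    using kernel_range fin
    by (intro P.integrable_unit_range borel_measurable_prod borel_measurable_bernoulli_count_mean
        measurable_kernel' prod_unit_range bernoulli_count_mean_range comp) (use K(3) in auto)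
  have pi: "integrable ?P (\<lambda>x. p (x u) (x v))" if "u \<in> K" "v \<in> K" for u v
    using that comp kernel_range by (intro P.integrable_unit_range measurable_kernel') auto
  have "\<bar>(\<integral>x. ?f x \<partial>?P) - (\<integral>x. ?h x \<partial>?P)\<bar> = \<bar>\<integral>x. ?f x - ?h x \<partial>?P\<bar>"
    using fi hi by (subst Bochner_Integration.integral_diff) auto
  also have "\<dots> \<le> (\<integral>x. ?s x \<partial>?P)"
    by (rule order.trans[OF integral_abs_bound integral_mono])
      (use fi hi pi diff K in \<open>auto intro!: Bochner_Integration.integrable_sum\<close>)
  also have "\<dots> = (\<Sum>v\<in>V. \<Sum>u\<in>K - {v}. \<integral>x. p (x u) (x v) \<partial>?P)"
    using pi K by (subst Bochner_Integration.integral_sum, force)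
      (intro sum.cong refl Bochner_Integration.integral_sum, force)
  also have "\<dots> = (\<Sum>v\<in>V. \<Sum>u\<in>K - {v}. edge_density)"
    unfolding P using fin K by (intro sum.cong refl expectation_kernel_PiM) auto
  also have "\<dots> \<le> (\<Sum>v\<in>K. \<Sum>u\<in>K. edge_density)"
    using fin K edge_density_range
    by (intro order.trans[OF sum_mono[OF sum_mono2] sum_mono2]) auto
  also have "\<dots> = (card K)\<^sup>2 * edge_density"
    by (simp add: power2_eq_square)
  finally have 1: "\<bar>(\<integral>x. ?f x \<partial>?P) - (\<integral>x. ?h x \<partial>?P)\<bar> \<le> (card K)\<^sup>2 * edge_density" .
  have "\<bar>(\<integral>x. ?h x \<partial>?P) - (\<Prod>v\<in>V. \<integral>x. (resample ^^ card W) (\<lambda>_ n. of_bool (n = k v)) x 0 \<partial>M)\<bar>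
      \<le> card W * ((card V)\<^sup>2 * ?\<delta>)"
    unfolding P using fin K by (intro count_means_near_independent) auto
  also have "\<dots> \<le> N * ((card K)\<^sup>2 * ?\<delta>)"
  proof -
    have "card W \<le> N" using K by (metis card_lessThan card_mono finite_lessThan sup_ge2)
    moreover have "card V \<le> card K" using K fin by (intro card_mono)
    ultimately show ?thesis
      using cherry_density_range by (intro mult_mono power_mono) auto
  qed
  finally show ?thesis
    using 1 meas by (simp add: algebra_simps)
qed

text \<open>\<open>degrees_near_product\<close> is used for all chosen vertices together and for
  each one alone, with the same \<open>K\<close>. One joint error and \<open>m\<close> errors in the
  factors make up \<open>1 + m\<close>.\<close>

lemma degrees_dependence_bound:
  fixes \<zeta> \<alpha> \<beta> :: real and v :: "nat \<Rightarrow> nat"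
  assumes "0 < \<zeta>" "0 < \<alpha>" "2 \<le> N" and v: "inj_on v {..<m}" "v ` {..<m} \<subseteq> {..<N}"
  defines "M \<equiv> point_measure_hyp \<alpha> (hyp_radius \<zeta> N)" and "p \<equiv> edge_prob \<zeta> \<beta> (hyp_radius \<zeta> N)"
  shows "\<bar>measure (hyp_random_graph N \<zeta> \<alpha> \<beta>) {G. \<forall>i<m. graph_degree G (v i) = k i}
      - (\<Prod>i<m. measure (hyp_random_graph N \<zeta> \<alpha> \<beta>) {G. graph_degree G (v i) = k i})\<bar>
    \<le> (1 + m) * (m\<^sup>2 * (symmetric_kernel.edge_density M p
        + N * (symmetric_kernel.cherry_density M p + (symmetric_kernel.edge_density M p)\<^sup>2)))"
proof -
  let ?K = "v ` {..<m}"
  let ?W = "{..<N} - ?K"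
  let ?H = "hyp_random_graph N \<zeta> \<alpha> \<beta>"
  interpret H: prob_space ?H
    using assms by (intro prob_space_hyp_random_graph)
  have R: "0 < hyp_radius \<zeta> N" using assms by (simp add: hyp_radius_def)
  interpret symmetric_kernel M p
    unfolding M_def p_def using assms(2) R by (rule symmetric_kernel_edge_prob)
  \<comment> \<open>The prescribed degrees are indexed by \<open>i < m\<close>; \<open>k'\<close>
    carries them over to the vertices.\<close>
  define k' where "k' u = k (the_inv_into {..<m} v u)" for u
  have k': "k' (v i) = k i" if "i < m" for i
    using that v by (simp add: k'_def the_inv_into_f_f)
  define C where "C u = (\<integral>x. (resample ^^ card ?W) (\<lambda>_ n. of_bool (n = k' u)) x 0 \<partial>M)" for u
  define \<epsilon> where "\<epsilon> = m\<^sup>2 * (edge_density + N * (cherry_density + edge_density\<^sup>2))"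
  have card: "card ?K = m" using v by (simp add: card_image)
  have main: "\<bar>measure ?H {G. \<forall>u\<in>V. graph_degree G u = k' u} - (\<Prod>u\<in>V. C u)\<bar> \<le> \<epsilon>" if "V \<subseteq> ?K" for V
    using degrees_near_product[of \<zeta> \<alpha> N ?K ?W V \<beta> k'] that assms
    by (simp add: C_def \<epsilon>_def card Un_absorb1)
  have single: "\<bar>measure ?H {G. graph_degree G (v i) = k i} - C (v i)\<bar> \<le> \<epsilon>" if "i < m" for i
    using main[of "{v i}"] that k' by simp
  have Cr: "C u \<in> {0..1}" for u
  proof -
    have "(\<forall>n. (\<lambda>x. (resample ^^ j) (\<lambda>_ n. of_bool (n = k' u)) x n) \<in> borel_measurable M) \<and>
        (\<forall>n. \<forall>x\<in>space M. (resample ^^ j) (\<lambda>_ n. of_bool (n = k' u)) x n \<in> {0..1})" for j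
      by (induction j) (auto intro!: measurable_resample resample_range simp del: atLeastAtMost_iff, auto)
    then show ?thesis
      unfolding C_def by (intro expectation_unit_range) blast+
  qed
  have "(\<Prod>u\<in>?K. C u) = (\<Prod>i<m. C (v i))"
    using v by (simp add: prod.reindex)
  moreover have "{G. \<forall>u\<in>?K. graph_degree G u = k' u} = {G. \<forall>i<m. graph_degree G (v i) = k i}"
    using k' by auto
  ultimately have joint: "\<bar>measure ?H {G. \<forall>i<m. graph_degree G (v i) = k i} - (\<Prod>i<m. C (v i))\<bar> \<le> \<epsilon>"
    using main[of ?K] by simp
  \<comment> \<open>All factors lie in the unit interval, so the products differ by at most the sum
    of the differences of their factors.\<close>
  have "\<bar>(\<Prod>i<m. C (v i)) - (\<Prod>i<m. measure ?H {G. graph_degree G (v i) = k i})\<bar>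
      \<le> (\<Sum>i<m. \<bar>C (v i) - measure ?H {G. graph_degree G (v i) = k i}\<bar>)"
    using Cr norm_prod_diff[of "{..<m}" "\<lambda>i. C (v i)" "\<lambda>i. measure ?H {G. graph_degree G (v i) = k i}"]
    by simp
  also have "\<dots> \<le> (\<Sum>i<m. \<epsilon>)"
    using single by (intro sum_mono) (simp add: abs_minus_commute)
  finally have "\<bar>measure ?H {G. \<forall>i<m. graph_degree G (v i) = k i}
      - (\<Prod>i<m. measure ?H {G. graph_degree G (v i) = k i})\<bar> \<le> (1 + m) * \<epsilon>"
    using joint by (simp add: algebra_simps)
  then show ?thesis
    by (simp add: \<epsilon>_def)
qed

section \<open>Edge probabilities in the hyperbolic plane\<close>

text \<open>
  The value \<open>\<top>\<close> at 0, where \<open>powr\<close> would give 0, makes the bound on edge probabilities hold for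
  coinciding angles as well.
\<close>

definition angle_kernel :: "real \<Rightarrow> ennreal" where
  "angle_kernel t = (if t = 0 then \<top> else ennreal ((\<bar>t\<bar> / 12) powr (-3/4)))"

lemma measurable_angle_kernel [measurable]: "angle_kernel \<in> borel_measurable borel"
  unfolding angle_kernel_def by measurable

text \<open>The Taylor error is at most \<open>x ^ 3 / 6\<close>, and
  \<open>x ^ 3 \<le> 4 * x\<close> on this interval. It is applied at half a relative angle, which
  is below 2.\<close>

lemma sin_ge_third:
  fixes x :: real
  assumes "0 \<le> x" "x \<le> 2"
  shows "x / 3 \<le> sin x"
proof -
  have "\<bar>sin x - x\<bar> \<le> x ^ 3 / 6"
    using Maclaurin_sin_bound[of x 3] assms
    by (simp add: sin_coeff_def numeral_3_eq_3 fact_numeral divide_simps)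
  moreover have "x ^ 3 \<le> 4 * x"
  proof -
    have "x * x \<le> 2 * 2" using assms by (intro mult_mono) auto
    then have "x * (x * x) \<le> x * 4" using assms by (intro mult_left_mono) auto
    then show ?thesis by (simp add: power3_eq_cube mult_ac)
  qed
  ultimately show ?thesis by linarith
qed

text \<open>The hyperbolic cosine of the scaled distance is at least \<open>cosh (\<zeta> * r) *
  cosh (\<zeta> * s) * (sin (\<phi> / 2))\<^sup>2\<close>. The square of 12 collects two factors 2
  from \<open>exp x \<le> 2 * cosh x\<close> and 36 from
  \<open>\<phi> / 6 \<le> sin (\<phi> / 2)\<close>.\<close>

lemma exp_hyp_dist_ge:
  assumes "0 < \<zeta>" "0 \<le> r" "0 \<le> s" and \<phi>: "rel_angle \<theta> \<theta>' = \<phi>" "0 \<le> \<phi>" "\<phi> \<le> pi"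
  shows "exp (\<zeta> * (r + s)) * (\<phi> / 12)\<^sup>2 \<le> exp (\<zeta> * hyp_dist \<zeta> (r, \<theta>) (s, \<theta>'))"
proof -
  let ?a = "cosh (\<zeta> * r)" and ?b = "cosh (\<zeta> * s)" and ?d = "\<zeta> * hyp_dist \<zeta> (r, \<theta>) (s, \<theta>')"
  let ?a' = "sinh (\<zeta> * r)" and ?b' = "sinh (\<zeta> * s)"
  have exp_le: "exp x \<le> 2 * cosh x" for x :: real
    by (simp add: cosh_def)
  have ab: "0 \<le> ?a' * ?b'" "?a' * ?b' \<le> ?a * ?b"
    using assms by (auto intro!: mult_mono sinh_le_cosh_real)
  have "exp (\<zeta> * (r + s)) * (\<phi> / 12)\<^sup>2 = (exp (\<zeta> * r) * exp (\<zeta> * s)) * (\<phi> / 2 / 3)\<^sup>2 / 4"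
    by (simp add: exp_add distrib_left power_divide)
  also have "\<dots> \<le> ((2 * ?a) * (2 * ?b)) * (sin (\<phi> / 2))\<^sup>2 / 4"
    using sin_ge_third[of "\<phi> / 2"] \<phi> pi_less_4
    by (intro divide_right_mono mult_mono power_mono exp_le) auto
  also have "\<dots> = ?a * ?b * (1 - cos \<phi>) / 2"
    using cos_double_sin[of "\<phi> / 2"] by simp
  \<comment> \<open>If \<open>cos \<phi>\<close> is nonnegative, \<open>sinh\<close> is replaced by
    the larger \<open>cosh\<close>; otherwise the subtracted term is nonpositive and
    \<open>(1 - cos \<phi>) / 2 \<le> 1\<close>.\<close>
  also have "\<dots> \<le> ?a * ?b - ?a' * ?b' * cos \<phi>"
  proof (cases "0 \<le> cos \<phi>")
    case True
    have "?a' * ?b' * cos \<phi> \<le> ?a * ?b * cos \<phi>"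
      using ab True by (intro mult_right_mono)
    moreover have "0 \<le> ?a * ?b * (1 - cos \<phi>)" by simp
    moreover have "?a * ?b * (1 - cos \<phi>) = ?a * ?b - ?a * ?b * cos \<phi>"
      by (simp add: right_diff_distrib)
    ultimately show ?thesis by linarith
  next
    case False
    have "?a * ?b * (1 - cos \<phi>) \<le> ?a * ?b * 2"
      by (intro mult_left_mono) (use cos_ge_minus_one[of \<phi>] in auto)
    moreover have "?a' * ?b' * cos \<phi> \<le> 0"
      using ab False by (intro mult_nonneg_nonpos) auto
    ultimately show ?thesis by linarith
  qed
  also have "\<dots> = cosh ?d"
    using hyp_dist_cosh(1)[of \<zeta> "(r, \<theta>)" "(s, \<theta>')"] assms by simp
  also have "\<dots> \<le> exp ?d"
    using hyp_dist_cosh(2)[of \<zeta> "(r, \<theta>)" "(s, \<theta>')"] assms by (simp add: cosh_def)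
  finally show ?thesis .
qed

text \<open>
  The exponent \<open>\<beta>\<close> may be lowered to any smaller one because a probability is at most 1. An
  exponent below 1 makes the singularity in the angle integrable; one above 1/2 suffices for the
  cherry density to be \<open>o(1/N)\<close>.
\<close>

lemma edge_prob_le:
  assumes "0 < \<zeta>" "3/4 \<le> \<beta>" "0 \<le> r" "0 \<le> s" "\<theta> \<in> {0<..2 * pi}" "\<theta>' \<in> {0<..2 * pi}"
  shows "ennreal (edge_prob \<zeta> \<beta> R (r, \<theta>) (s, \<theta>')) \<le>
    ennreal (exp (3/8 * \<zeta> * (R - s)) * exp (- (3/8 * \<zeta>) * r)) *
      (angle_kernel (\<theta> - \<theta>') + angle_kernel (\<theta> - \<theta>' - 2 * pi) + angle_kernel (\<theta> - \<theta>' + 2 * pi))"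
proof -
  define \<phi> where "\<phi> = rel_angle \<theta> \<theta>'"
  have \<phi>: "0 \<le> \<phi>" "\<phi> \<le> pi"
    using rel_angle_props(1)[OF assms(5,6)] by (auto simp: \<phi>_def)
  \<comment> \<open>The relative angle is the distance of \<open>\<theta> - \<theta>'\<close> from
    0, \<open>2 * pi\<close> or \<open>- 2 * pi\<close>. Summing the kernel over all three gives
    translates that can be integrated term by term.\<close>
  have "\<phi> = \<bar>\<theta> - \<theta>'\<bar> \<or> \<phi> = \<bar>\<theta> - \<theta>' - 2 * pi\<bar> \<or> \<phi> = \<bar>\<theta> - \<theta>' + 2 * pi\<bar>"
    using assms by (auto simp: \<phi>_def rel_angle_def abs_if)
  moreover have "angle_kernel \<bar>t\<bar> = angle_kernel t" for t
    by (simp add: angle_kernel_def)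
  ultimately have "angle_kernel \<phi> \<in> {angle_kernel (\<theta> - \<theta>'), angle_kernel (\<theta> - \<theta>' - 2 * pi), angle_kernel (\<theta> - \<theta>' + 2 * pi)}"
    by auto
  then have K: "angle_kernel \<phi> \<le>
      angle_kernel (\<theta> - \<theta>') + angle_kernel (\<theta> - \<theta>' - 2 * pi) + angle_kernel (\<theta> - \<theta>' + 2 * pi)"
    by (auto simp: add_increasing add_increasing2)
  have "ennreal (edge_prob \<zeta> \<beta> R (r, \<theta>) (s, \<theta>')) \<le>
      ennreal (exp (3/8 * \<zeta> * (R - s)) * exp (- (3/8 * \<zeta>) * r)) * angle_kernel \<phi>"
  proof (cases "\<phi> = 0")
    case True
    then show ?thesis by (simp add: angle_kernel_def ennreal_mult_top)
  next
    case False
    let ?d = "hyp_dist \<zeta> (r, \<theta>) (s, \<theta>')"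
    \<comment> \<open>The exponent of the edge probability without the factor
      \<open>\<beta>\<close>; \<open>exp_hyp_dist_ge\<close> bounds it below by a radial term plus
      the logarithm of the angle.\<close>
    define y where "y = \<zeta> / 2 * (?d - R)"
    have pos: "0 < \<phi> / 12" using False \<phi> by simp
    have "exp (\<zeta> * (r + s) + 2 * ln (\<phi> / 12)) = exp (\<zeta> * (r + s)) * (\<phi> / 12)\<^sup>2"
      using pos by (simp add: exp_add exp_double)
    also have "\<dots> \<le> exp (\<zeta> * ?d)"
      using assms \<phi> by (intro exp_hyp_dist_ge) (auto simp: \<phi>_def)
    finally have le: "\<zeta> * (r + s) + 2 * ln (\<phi> / 12) \<le> \<zeta> * ?d"
      by simp
    have y_eq: "y = (\<zeta> * ?d - \<zeta> * R) / 2" "\<zeta> / 2 * (r + s - R) = (\<zeta> * (r + s) - \<zeta> * R) / 2"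
      by (simp_all add: y_def right_diff_distrib)
    have y: "\<zeta> / 2 * (r + s - R) + ln (\<phi> / 12) \<le> y"
      unfolding y_eq using le by (simp add: diff_divide_distrib)
    have "edge_prob \<zeta> \<beta> R (r, \<theta>) (s, \<theta>') = 1 / (exp (\<beta> * y) + 1)"
      by (simp add: edge_prob_def y_def mult_ac)
    also have "\<dots> \<le> exp (- (3/4 * y))"
    proof (cases "0 \<le> y")
      case True
      then have "exp (3/4 * y) \<le> exp (\<beta> * y) + 1"
        using mult_right_mono[OF assms(2), of y] by (intro add_increasing2) auto
      then have "1 / (exp (\<beta> * y) + 1) \<le> 1 / exp (3/4 * y)"
        by (intro divide_left_mono mult_pos_pos) (auto intro: add_pos_pos)
      then show ?thesis by (simp add: exp_minus divide_simps)
    next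
      case False
      then have "1 \<le> exp (- (3/4 * y))" by simp
      moreover have "1 / (exp (\<beta> * y) + 1) \<le> 1" by (simp add: add_pos_pos)
      ultimately show ?thesis by linarith
    qed
    also have "\<dots> \<le> exp (- (3/4 * (\<zeta> / 2 * (r + s - R) + ln (\<phi> / 12))))"
      using y by simp
    also have "\<dots> = exp (3/8 * \<zeta> * (R - s)) * exp (- (3/8 * \<zeta>) * r) * (\<phi> / 12) powr (-3/4)"
      using pos by (simp add: powr_def exp_add[symmetric] algebra_simps add_divide_distrib diff_divide_distrib)
    finally have "ennreal (edge_prob \<zeta> \<beta> R (r, \<theta>) (s, \<theta>')) \<le>
        ennreal (exp (3/8 * \<zeta> * (R - s)) * exp (- (3/8 * \<zeta>) * r) * (\<phi> / 12) powr (-3/4))"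
      by (rule ennreal_leI)
    then show ?thesis
      using False \<phi> by (simp add: angle_kernel_def ennreal_mult'')
  qed
  also have "\<dots> \<le> ennreal (exp (3/8 * \<zeta> * (R - s)) * exp (- (3/8 * \<zeta>) * r)) *
      (angle_kernel (\<theta> - \<theta>') + angle_kernel (\<theta> - \<theta>' - 2 * pi) + angle_kernel (\<theta> - \<theta>' + 2 * pi))"
    using K by (intro mult_left_mono) auto
  finally show ?thesis .
qed

section \<open>Angular and radial integrals\<close>

lemma angle_kernel_integral_finite:
  "(\<integral>\<^sup>+t. angle_kernel t * indicator {- (4 * pi)..4 * pi} t \<partial>lborel) < \<top>"
proof -
  let ?g = "\<lambda>t::real. ennreal ((t / 12) powr (-3/4)) * indicator {0..4 * pi} t"
  have "((\<lambda>t. t powr (-3/4)) has_integral ((4 * pi) powr (-3/4 + 1) / (-3/4 + 1))) {0..4 * pi}"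
    by (rule has_integral_powr_from_0) auto
  then have "((\<lambda>t. t powr (-3/4) / 12 powr (-3/4)) has_integral ((4 * pi) powr (-3/4 + 1) / (-3/4 + 1)) / 12 powr (-3/4)) {0..4 * pi}"
    by (rule has_integral_divide)
  then have "((\<lambda>t. (t / 12) powr (-3/4)) has_integral ((4 * pi) powr (-3/4 + 1) / (-3/4 + 1)) / 12 powr (-3/4)) {0..4 * pi}"
    by (rule has_integral_eq[rotated]) (simp add: powr_divide)
  then have g: "(\<integral>\<^sup>+t. ?g t \<partial>lborel) < \<top>"
    by (subst nn_integral_has_integral_lebesgue') auto
  \<comment> \<open>The kernel is even, so the half-lines are reflections of each other; the value
    \<top> at the origin disappears with a null set.\<close>
  have "(\<integral>\<^sup>+t. angle_kernel t * indicator {- (4 * pi)..4 * pi} t \<partial>lborel) \<le> (\<integral>\<^sup>+t. ?g t + ?g (- t) \<partial>lborel)"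
  proof (rule nn_integral_mono_AE)
    show "AE t in lborel. angle_kernel t * indicator {- (4 * pi)..4 * pi} t \<le> ?g t + ?g (- t)"
      using AE_lborel_singleton[of "0::real"]
    proof eventually_elim
      case (elim t)
      then show ?case
        by (cases "0 < t") (auto simp: angle_kernel_def indicator_def)
    qed
  qed
  also have "\<dots> = (\<integral>\<^sup>+t. ?g t \<partial>lborel) + (\<integral>\<^sup>+t. ?g (- t) \<partial>lborel)"
    by (rule nn_integral_add) measurable
  also have "(\<integral>\<^sup>+t. ?g (- t) \<partial>lborel) = (\<integral>\<^sup>+t. ?g t \<partial>lborel)"
    by (subst (2) nn_integral_real_affine[where c = "-1" and t = 0]) (simp_all del: indicator_simps)
  finally show ?thesis
    using g by (auto intro: le_less_trans)
qed

text \<open>By translation invariance: the argument of the kernel stays in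
  \<open>{- (4 * pi)..4 * pi}\<close>. The bound is the same for all
  \<open>\<theta>'\<close>.\<close>

lemma angle_kernel_shift_le:
  assumes "\<theta>' \<in> {0<..2 * pi}" "\<bar>c\<bar> \<le> 2 * pi"
  shows "(\<integral>\<^sup>+\<theta>. angle_kernel (\<theta> - \<theta>' + c) * indicator {0<..2 * pi} \<theta> \<partial>lborel)
    \<le> (\<integral>\<^sup>+t. angle_kernel t * indicator {- (4 * pi)..4 * pi} t \<partial>lborel)"
proof -
  have "(\<integral>\<^sup>+\<theta>. angle_kernel (\<theta> - \<theta>' + c) * indicator {0<..2 * pi} \<theta> \<partial>lborel) \<le>
      (\<integral>\<^sup>+\<theta>. angle_kernel (c - \<theta>' + 1 * \<theta>) * indicator {- (4 * pi)..4 * pi} (c - \<theta>' + 1 * \<theta>) \<partial>lborel)"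
    using assms
    by (intro nn_integral_mono) (auto simp: indicator_def algebra_simps abs_le_iff)
  also have "\<dots> = (\<integral>\<^sup>+t. angle_kernel t * indicator {- (4 * pi)..4 * pi} t \<partial>lborel)"
    by (subst (2) nn_integral_real_affine[where c = 1 and t = "c - \<theta>'"]) simp_all
  finally show ?thesis .
qed

text \<open>Radii outside the disc and angles outside \<open>{0<..2 * pi}\<close> are null sets, so
  a product bound on the remaining points is enough to separate the variables.\<close>

lemma nn_integral_point_measure_hyp_le:
  fixes f :: "real \<times> real \<Rightarrow> ennreal"
  assumes "0 < \<alpha>" "0 < R"
    and "f \<in> borel_measurable (point_measure_hyp \<alpha> R)"
    and [measurable]: "A \<in> borel_measurable borel" "B \<in> borel_measurable borel"
    and le: "\<And>r \<theta>. 0 \<le> r \<Longrightarrow> r \<le> R \<Longrightarrow> \<theta> \<in> {0<..2 * pi} \<Longrightarrow> f (r, \<theta>) \<le> A r * B \<theta>"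
  shows "(\<integral>\<^sup>+z. f z \<partial>point_measure_hyp \<alpha> R) \<le>
    (\<integral>\<^sup>+r. A r \<partial>density lborel (\<lambda>r. ennreal (radius_density \<alpha> R r))) *
      (\<integral>\<^sup>+\<theta>. B \<theta> \<partial>uniform_measure lborel {0<..2 * pi})"
proof -
  let ?D = "density lborel (\<lambda>r. ennreal (radius_density \<alpha> R r))" and ?U = "uniform_measure lborel {0<..2 * pi}"
  interpret D: prob_space ?D
    using assms(1,2) by (rule prob_space_radius)
  interpret U: prob_space ?U
    by (rule prob_space_uniform_measure) auto
  have [measurable]: "(sinh :: real \<Rightarrow> real) \<in> borel_measurable borel"
    by (auto intro!: borel_measurable_continuous_onI continuous_intros)
  have [measurable]: "radius_density \<alpha> R \<in> borel_measurable borel"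
    unfolding radius_density_def[abs_def] by measurable
  have AU: "AE \<theta> in ?U. \<theta> \<in> {0<..2 * pi}"
    by (intro AE_uniform_measureI) auto
  have AD: "AE r in ?D. 0 \<le> r \<and> r \<le> R"
    by (subst AE_density) (auto simp: radius_density_def)
  have "(\<integral>\<^sup>+z. f z \<partial>point_measure_hyp \<alpha> R) = (\<integral>\<^sup>+r. (\<integral>\<^sup>+\<theta>. f (r, \<theta>) \<partial>?U) \<partial>?D)"
    using assms(3) unfolding point_measure_hyp_def by (rule U.nn_integral_fst[symmetric])
  also have "\<dots> \<le> (\<integral>\<^sup>+r. (\<integral>\<^sup>+\<theta>. A r * B \<theta> \<partial>?U) \<partial>?D)"
    using AD
    by (intro nn_integral_mono_AE, eventually_elim) (use AU le in \<open>auto intro!: nn_integral_mono_AE elim: eventually_mono\<close>)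
  also have "\<dots> = (\<integral>\<^sup>+r. A r \<partial>?D) * (\<integral>\<^sup>+\<theta>. B \<theta> \<partial>?U)"
    by (simp add: nn_integral_cmult nn_integral_multc)
  finally show ?thesis .
qed

text \<open>The condition on \<open>R\<close> gives
  \<open>exp (\<alpha> * R) / 4 \<le> cosh (\<alpha> * R) - 1\<close>, hence a density of at most
  \<open>2 * \<alpha> * exp (\<alpha> * (r - R))\<close>. As \<open>c < \<alpha>\<close>, the
  integral is governed by its upper end.\<close>

lemma radial_exp_integral_le:
  assumes "0 < \<alpha>" "0 < R" "4 \<le> exp (\<alpha> * R)" "c < \<alpha>"
  shows "(\<integral>\<^sup>+r. ennreal (exp (- c * r)) \<partial>density lborel (\<lambda>r. ennreal (radius_density \<alpha> R r)))
    \<le> ennreal (2 * \<alpha> / (\<alpha> - c) * exp (- c * R))"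
proof -
  have [measurable]: "(sinh :: real \<Rightarrow> real) \<in> borel_measurable borel"
    by (auto intro!: borel_measurable_continuous_onI continuous_intros)
  have [measurable]: "radius_density \<alpha> R \<in> borel_measurable borel"
    unfolding radius_density_def[abs_def] by measurable
  let ?k = "2 * \<alpha> * exp (- \<alpha> * R)"
  let ?F = "\<lambda>r. ?k / (\<alpha> - c) * exp ((\<alpha> - c) * r)"
  have cosh: "exp (\<alpha> * R) / 4 \<le> cosh (\<alpha> * R) - 1"
  proof -
    have "exp (\<alpha> * R) / 2 \<le> cosh (\<alpha> * R)" by (simp add: cosh_def)
    then show ?thesis using assms(3) by linarith
  qed
  have le: "radius_density \<alpha> R r * exp (- c * r) \<le> ?k * exp ((\<alpha> - c) * r)" if "0 \<le> r" "r \<le> R" for r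
  proof -
    have "\<alpha> * sinh (\<alpha> * r) / (cosh (\<alpha> * R) - 1) \<le> \<alpha> * (exp (\<alpha> * r) / 2) / (exp (\<alpha> * R) / 4)"
      using cosh assms that by (intro frac_le mult_left_mono) (auto simp: sinh_def)
    also have "\<dots> = ?k * exp (\<alpha> * r)"
      by (simp add: exp_minus divide_simps)
    finally have "radius_density \<alpha> R r \<le> ?k * exp (\<alpha> * r)"
      using that by (simp add: radius_density_def)
    then have "radius_density \<alpha> R r * exp (- c * r) \<le> ?k * exp (\<alpha> * r) * exp (- c * r)"
      by (intro mult_right_mono) auto
    also have "\<dots> = ?k * exp ((\<alpha> - c) * r)"
      by (simp add: exp_add[symmetric] algebra_simps)
    finally show ?thesis .
  qed
  have "(\<integral>\<^sup>+r. ennreal (exp (- c * r)) \<partial>density lborel (\<lambda>r. ennreal (radius_density \<alpha> R r)))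
      = (\<integral>\<^sup>+r. ennreal (radius_density \<alpha> R r) * ennreal (exp (- c * r)) \<partial>lborel)"
    by (subst nn_integral_density) auto
  also have "\<dots> \<le> (\<integral>\<^sup>+r. ennreal (?k * exp ((\<alpha> - c) * r)) * indicator {0..R} r \<partial>lborel)"
  proof (rule nn_integral_mono)
    fix r
    show "ennreal (radius_density \<alpha> R r) * ennreal (exp (- c * r)) \<le> ennreal (?k * exp ((\<alpha> - c) * r)) * indicator {0..R} r"
      using le[of r]
      by (cases "0 \<le> r \<and> r \<le> R") (auto simp: ennreal_mult''[symmetric] radius_density_def intro!: ennreal_leI)
  qed
  also have "\<dots> = ennreal (?F R - ?F 0)"
    by (rule nn_integral_FTC_Icc) (use assms in \<open>auto intro!: derivative_eq_intros\<close>)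
  also have "\<dots> \<le> ennreal (?F R)"
    using assms by (intro ennreal_leI) simp
  also have "?F R = 2 * \<alpha> / (\<alpha> - c) * exp (- c * R)"
  proof -
    have "exp (- \<alpha> * R) * exp ((\<alpha> - c) * R) = exp (- c * R)"
      by (simp add: exp_add[symmetric] algebra_simps)
    then show ?thesis by simp
  qed
  finally show ?thesis .
qed

text \<open>Each of the three translates is bounded by the same integral for every
  \<open>\<theta>'\<close>; dividing by \<open>2 * pi\<close> normalises the uniform
  measure.\<close>

lemma angle_integral_bounded:
  "\<exists>T\<ge>0. \<forall>\<theta>'\<in>{0<..2 * pi}.
    (\<integral>\<^sup>+\<theta>. angle_kernel (\<theta> - \<theta>') + angle_kernel (\<theta> - \<theta>' - 2 * pi) + angle_kernel (\<theta> - \<theta>' + 2 * pi)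
      \<partial>uniform_measure lborel {0<..2 * pi}) \<le> ennreal T"
proof -
  define S where "S = (\<integral>\<^sup>+t. angle_kernel t * indicator {- (4 * pi)..4 * pi} t \<partial>lborel)"
  define T where "T = (S + S + S) / ennreal (2 * pi)"
  have "T < \<top>"
    using angle_kernel_integral_finite
    by (auto simp: T_def S_def divide_ennreal_def ennreal_mult_less_top inverse_ennreal)
  moreover have "(\<integral>\<^sup>+\<theta>. angle_kernel (\<theta> - \<theta>') + angle_kernel (\<theta> - \<theta>' - 2 * pi) + angle_kernel (\<theta> - \<theta>' + 2 * pi)
      \<partial>uniform_measure lborel {0<..2 * pi}) \<le> T" if \<theta>': "\<theta>' \<in> {0<..2 * pi}" for \<theta>'
  proof -
    let ?I = "indicator {0<..2 * pi} :: real \<Rightarrow> ennreal"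
    have "(\<integral>\<^sup>+\<theta>. (angle_kernel (\<theta> - \<theta>') + angle_kernel (\<theta> - \<theta>' - 2 * pi) + angle_kernel (\<theta> - \<theta>' + 2 * pi)) * ?I \<theta> \<partial>lborel)
        = (\<integral>\<^sup>+\<theta>. angle_kernel (\<theta> - \<theta>' + 0) * ?I \<theta> \<partial>lborel)
        + (\<integral>\<^sup>+\<theta>. angle_kernel (\<theta> - \<theta>' + - (2 * pi)) * ?I \<theta> \<partial>lborel)
        + (\<integral>\<^sup>+\<theta>. angle_kernel (\<theta> - \<theta>' + 2 * pi) * ?I \<theta> \<partial>lborel)"
      by (simp add: nn_integral_add[symmetric] distrib_right)
    also have "\<dots> \<le> S + S + S"
      unfolding S_def using \<theta>' by (intro add_mono angle_kernel_shift_le) auto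
    finally show ?thesis
      by (subst nn_integral_uniform_measure) (auto simp: T_def intro!: divide_right_mono_ennreal)
  qed
  ultimately show ?thesis
    by (intro exI[of _ "enn2real T"]) (auto simp: ennreal_enn2real)
qed

text \<open>At radius \<open>s\<close> the mean edge probability is
  \<open>O(exp (- \<gamma> * s))\<close> with \<open>\<gamma> = 3/8 * \<zeta>\<close>. Since
  \<open>c \<le> 2 * \<gamma>\<close> and \<open>c < \<alpha>\<close>, integrating its square over
  the radius yields the rate \<open>c\<close>, with a constant independent of
  \<open>R\<close>.\<close>

lemma cherry_density_bound:
  fixes \<zeta> \<alpha> \<beta> c :: real
  assumes "0 < \<zeta>" "3/4 \<le> \<beta>" "\<zeta> / 2 < \<alpha>" "c < \<alpha>" "c \<le> 3/4 * \<zeta>"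
  shows "\<exists>C\<ge>0. \<forall>R>0. 4 \<le> exp (\<alpha> * R) \<longrightarrow>
    symmetric_kernel.cherry_density (point_measure_hyp \<alpha> R) (edge_prob \<zeta> \<beta> R) \<le> C * exp (- c * R)"
proof -
  obtain T where T: "0 \<le> T" "\<And>\<theta>'. \<theta>' \<in> {0<..2 * pi} \<Longrightarrow>
    (\<integral>\<^sup>+\<theta>. angle_kernel (\<theta> - \<theta>') + angle_kernel (\<theta> - \<theta>' - 2 * pi) + angle_kernel (\<theta> - \<theta>' + 2 * pi)
      \<partial>uniform_measure lborel {0<..2 * pi}) \<le> ennreal T"
    using angle_integral_bounded by blast
  define \<gamma> where "\<gamma> = 3/8 * \<zeta>"
  have \<alpha>: "0 < \<alpha>" "\<gamma> < \<alpha>" using assms by (auto simp: \<gamma>_def)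
  \<comment> \<open>The constant of the radial integral at rate \<open>\<gamma>\<close>, times the
    angular bound \<open>T\<close>.\<close>
  define D where "D = 2 * \<alpha> / (\<alpha> - \<gamma>) * T"
  have D: "0 \<le> D" using \<alpha> T by (simp add: D_def)
  have "symmetric_kernel.cherry_density (point_measure_hyp \<alpha> R) (edge_prob \<zeta> \<beta> R)
      \<le> D\<^sup>2 * (2 * \<alpha> / (\<alpha> - c)) * exp (- c * R)" if R: "0 < R" "4 \<le> exp (\<alpha> * R)" for R
  proof -
    let ?M = "point_measure_hyp \<alpha> R" and ?p = "edge_prob \<zeta> \<beta> R"
    let ?D = "density lborel (\<lambda>r. ennreal (radius_density \<alpha> R r))" and ?U = "uniform_measure lborel {0<..2 * pi}"
    interpret symmetric_kernel ?M ?p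
      using \<alpha>(1) R(1) by (rule symmetric_kernel_edge_prob)
    interpret U: prob_space ?U
      by (rule prob_space_uniform_measure) auto
    have space: "space ?M = UNIV"
      by (simp add: point_measure_hyp_def space_pair_measure)
    have mean: "edge_mean (s, \<theta>') \<le> D * exp (- \<gamma> * s)" if s: "0 \<le> s" and \<theta>': "\<theta>' \<in> {0<..2 * pi}" for s \<theta>'
    proof -
      let ?B = "\<lambda>\<theta>. angle_kernel (\<theta> - \<theta>') + angle_kernel (\<theta> - \<theta>' - 2 * pi) + angle_kernel (\<theta> - \<theta>' + 2 * pi)"
      let ?e = "exp (\<gamma> * (R - s))"
      have pm: "(\<lambda>x. ?p x (s, \<theta>')) \<in> borel_measurable ?M"
        by (intro measurable_kernel') (auto simp: space)
      have "ennreal (edge_mean (s, \<theta>')) = (\<integral>\<^sup>+x. ennreal (?p x (s, \<theta>')) \<partial>?M)"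
        unfolding edge_mean_def
        using pm kernel_range by (intro nn_integral_eq_integral[symmetric] integrable_unit_range) auto
      also have "\<dots> \<le> (\<integral>\<^sup>+r. ennreal (?e * exp (- \<gamma> * r)) \<partial>?D) * (\<integral>\<^sup>+\<theta>. ?B \<theta> \<partial>?U)"
      proof (rule nn_integral_point_measure_hyp_le[OF \<alpha>(1) R(1)])
        fix r \<theta> assume "0 \<le> r" "r \<le> R" "\<theta> \<in> {0<..2 * pi}"
        then show "ennreal (?p (r, \<theta>) (s, \<theta>')) \<le> ennreal (?e * exp (- \<gamma> * r)) * ?B \<theta>"
          unfolding \<gamma>_def using assms s \<theta>' by (intro edge_prob_le)
      qed (use pm in auto)
      also have "(\<integral>\<^sup>+r. ennreal (?e * exp (- \<gamma> * r)) \<partial>?D) = ennreal ?e * (\<integral>\<^sup>+r. ennreal (exp (- \<gamma> * r)) \<partial>?D)"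
        by (simp add: ennreal_mult' nn_integral_cmult)
      also have "\<dots> * (\<integral>\<^sup>+\<theta>. ?B \<theta> \<partial>?U) \<le>
          ennreal ?e * ennreal (2 * \<alpha> / (\<alpha> - \<gamma>) * exp (- \<gamma> * R)) * ennreal T"
        using \<alpha> R by (intro mult_mono T(2)[OF \<theta>'] radial_exp_integral_le) auto
      also have "\<dots> = ennreal (?e * (2 * \<alpha> / (\<alpha> - \<gamma>) * exp (- \<gamma> * R)) * T)"
        using T(1) \<alpha> by (simp add: ennreal_mult'[symmetric])
      also have "?e * (2 * \<alpha> / (\<alpha> - \<gamma>) * exp (- \<gamma> * R)) * T = D * (?e * exp (- \<gamma> * R))"
        by (simp add: D_def)
      \<comment> \<open>The growth in \<open>R\<close> of the edge bound cancels against the radial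
        integral.\<close>
      also have "?e * exp (- \<gamma> * R) = exp (- \<gamma> * s)"
        by (simp add: exp_add[symmetric] algebra_simps)
      finally show ?thesis
        using D by (subst (asm) ennreal_le_iff) auto
    qed
    have "ennreal cherry_density = (\<integral>\<^sup>+y. ennreal (edge_mean y * edge_mean y) \<partial>?M)"
      unfolding cherry_density_def
      using edge_mean_range by (intro nn_integral_eq_integral[symmetric] integrable_unit_range)
        (auto intro!: mult_le_one)
    also have "\<dots> \<le> (\<integral>\<^sup>+r. ennreal (D\<^sup>2 * exp (- c * r)) \<partial>?D) * (\<integral>\<^sup>+\<theta>. 1 \<partial>?U)"
    proof (rule nn_integral_point_measure_hyp_le[OF \<alpha>(1) R(1)])
      fix s \<theta>' assume s: "0 \<le> s" "s \<le> R" "\<theta>' \<in> {0<..2 * pi}"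
      have "edge_mean (s, \<theta>') * edge_mean (s, \<theta>') \<le> (D * exp (- \<gamma> * s)) * (D * exp (- \<gamma> * s))"
        using mean[OF s(1,3)] edge_mean_range[of "(s, \<theta>')"] by (intro mult_mono) (auto simp: space)
      also have "\<dots> = D\<^sup>2 * exp (- (2 * \<gamma>) * s)"
        by (simp add: power2_eq_square exp_add[symmetric])
      also have "\<dots> \<le> D\<^sup>2 * exp (- c * s)"
        using s mult_right_mono[OF assms(5), of s] by (intro mult_left_mono) (auto simp: \<gamma>_def)
      finally show "ennreal (edge_mean (s, \<theta>') * edge_mean (s, \<theta>')) \<le> ennreal (D\<^sup>2 * exp (- c * s)) * 1"
        by (simp add: ennreal_leI)
    qed auto
    also have "\<dots> = ennreal (D\<^sup>2) * (\<integral>\<^sup>+r. ennreal (exp (- c * r)) \<partial>?D)"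
      using U.emeasure_space_1 by (simp add: ennreal_mult' nn_integral_cmult)
    also have "\<dots> \<le> ennreal (D\<^sup>2) * ennreal (2 * \<alpha> / (\<alpha> - c) * exp (- c * R))"
      using \<alpha> R assms by (intro mult_left_mono radial_exp_integral_le) auto
    also have "\<dots> = ennreal (D\<^sup>2 * (2 * \<alpha> / (\<alpha> - c)) * exp (- c * R))"
      by (simp add: ennreal_mult'[symmetric] mult.assoc)
    finally show ?thesis
      using \<alpha> assms by (subst (asm) ennreal_le_iff) auto
  qed
  then show ?thesis
    using \<alpha> assms by (intro exI[of _ "D\<^sup>2 * (2 * \<alpha> / (\<alpha> - c))"]) auto
qed

section \<open>Choice of the decay rate and passage to the limit\<close>

theorem theorem4p1:
  fixes \<zeta> \<alpha> \<beta> :: real and m :: nat and k :: "nat \<Rightarrow> nat"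
  assumes "0 < \<zeta>" "\<zeta> < 2" "\<alpha> > 0" "\<beta> > 0"
    and "\<beta> > 1" "0 < \<zeta> / \<alpha>" "\<zeta> / \<alpha> < 2"
    and "m \<ge> 2"
  shows "\<forall>\<epsilon>>0. \<forall>\<^sub>F N in sequentially. \<forall>v. inj_on v {..<m} \<and> v ` {..<m} \<subseteq> {..<N} \<longrightarrow>
    \<bar>\<P>(G in hyp_random_graph N \<zeta> \<alpha> \<beta>. \<forall>i<m. graph_degree G (v i) = k i)
       - (\<Prod>i<m. \<P>(G in hyp_random_graph N \<zeta> \<alpha> \<beta>. graph_degree G (v i) = k i))\<bar> < \<epsilon>"
proof (intro allI impI)
  fix \<epsilon> :: real
  assume \<epsilon>: "0 < \<epsilon>"
  have \<alpha>: "\<zeta> / 2 < \<alpha>"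
    using assms by (simp add: field_simps)
  \<comment> \<open>The midpoint between \<open>\<zeta> / 2\<close> and the smaller of the upper
    limits \<open>\<alpha>\<close> and \<open>3/4 * \<zeta>\<close>, both of which exceed
    \<open>\<zeta> / 2\<close>.\<close>
  define c where "c = (\<zeta> / 2 + min \<alpha> (3/4 * \<zeta>)) / 2"
  have c: "\<zeta> / 2 < c" "c < \<alpha>" "c \<le> 3/4 * \<zeta>"
    using \<alpha> assms(1) by (auto simp: c_def min_def)
  obtain C where C: "0 \<le> C" "\<And>R. 0 < R \<Longrightarrow> 4 \<le> exp (\<alpha> * R) \<Longrightarrow>
      symmetric_kernel.cherry_density (point_measure_hyp \<alpha> R) (edge_prob \<zeta> \<beta> R) \<le> C * exp (- c * R)"
    using cherry_density_bound[of \<zeta> \<beta> \<alpha> c] assms \<alpha> c by auto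
  \<comment> \<open>Since the radius is \<open>2 / \<zeta> * ln N\<close>, the decay
    \<open>exp (- c * R)\<close> equals \<open>N powr - \<eta>\<close>, and
    \<open>1 < \<eta>\<close> outweighs the factor \<open>N\<close>.\<close>
  define \<eta> where "\<eta> = 2 * c / \<zeta>"
  have \<eta>: "1 < \<eta>" using c assms by (simp add: \<eta>_def field_simps)
  \<comment> \<open>The bound of \<open>degrees_dependence_bound\<close> after estimating the cherry
    density and the squared edge density by \<open>C * N powr - \<eta>\<close>. No vertex occurs in
    it, whence the uniformity.\<close>
  define bd where "bd N = (1 + real m) * ((real m)\<^sup>2 * (sqrt (C * real N powr - \<eta>)
      + real N * (2 * (C * real N powr - \<eta>))))" for N :: nat
  have bd0: "bd \<longlonglongrightarrow> 0"
  proof -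
    have "(\<lambda>N::nat. real N powr - \<eta>) \<longlonglongrightarrow> 0" "(\<lambda>N::nat. real N * real N powr - \<eta>) \<longlonglongrightarrow> 0"
      using \<eta> by real_asymp+
    then have "(\<lambda>N::nat. (1 + real m) * ((real m)\<^sup>2 * (sqrt (C * real N powr - \<eta>)
        + 2 * C * (real N * real N powr - \<eta>)))) \<longlonglongrightarrow> (1 + real m) * ((real m)\<^sup>2 * (sqrt (C * 0) + 2 * C * 0))"
      by (intro tendsto_intros)
    then show ?thesis by (simp add: bd_def[abs_def] mult_ac)
  qed
  have "eventually (\<lambda>N. bd N < \<epsilon>) sequentially"
    using order_tendstoD(2)[OF bd0 \<epsilon>] .
  moreover have "eventually (\<lambda>N. 4 \<le> exp (\<alpha> * hyp_radius \<zeta> N)) sequentially"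
    unfolding hyp_radius_def using assms(1,3) by real_asymp
  moreover have "eventually (\<lambda>N::nat. 2 \<le> N) sequentially"
    by (rule eventually_ge_at_top)
  ultimately show "\<forall>\<^sub>F N in sequentially. \<forall>v. inj_on v {..<m} \<and> v ` {..<m} \<subseteq> {..<N} \<longrightarrow>
    \<bar>\<P>(G in hyp_random_graph N \<zeta> \<alpha> \<beta>. \<forall>i<m. graph_degree G (v i) = k i)
       - (\<Prod>i<m. \<P>(G in hyp_random_graph N \<zeta> \<alpha> \<beta>. graph_degree G (v i) = k i))\<bar> < \<epsilon>"
  proof eventually_elim
    case (elim N)
    let ?R = "hyp_radius \<zeta> N"
    have R: "0 < ?R" using elim assms by (simp add: hyp_radius_def)
    interpret symmetric_kernel "point_measure_hyp \<alpha> ?R" "edge_prob \<zeta> \<beta> ?R"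
      using assms(3) R by (rule symmetric_kernel_edge_prob)
    have "exp (- c * ?R) = real N powr - \<eta>"
      using elim by (simp add: powr_def hyp_radius_def \<eta>_def)
    then have b: "cherry_density \<le> C * real N powr - \<eta>"
      using C(2)[OF R] elim by simp
    have a: "edge_density \<le> sqrt (C * real N powr - \<eta>)" "edge_density\<^sup>2 \<le> C * real N powr - \<eta>"
      using b edge_density_square_le by (auto intro!: real_le_rsqrt)
    have "(1 + real m) * ((real m)\<^sup>2 * (edge_density + real N * (cherry_density + edge_density\<^sup>2))) \<le> bd N"
      unfolding bd_def using a b by (intro mult_left_mono add_mono) auto
    then have "(1 + real m) * ((real m)\<^sup>2 * (edge_density + real N * (cherry_density + edge_density\<^sup>2))) < \<epsilon>"
      using elim by simp
    moreover have "space (hyp_random_graph N \<zeta> \<alpha> \<beta>) = UNIV"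
      using assms elim by (intro prob_space_hyp_random_graph)
    ultimately show ?case
      using degrees_dependence_bound[of \<zeta> \<alpha> N _ m \<beta> k] assms elim
      by (auto intro: le_less_trans)
  qed
qed

end
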